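(* If a tubular group is free-by-cyclic, then it is $F_n$-by-$\mathbb{Z}$ for some finite $n$. If a tubular group is virtually free-by-cyclic, then it is virtually $F_n$-by-$\mathbb{Z}$ for some finite $n$.
   Context: A tubular group is a group that splits as a finite graph of groups with all vertex groups isomorphic to $\mathbb{Z}^2$ and all edge groups isomorphic to $\mathbb{Z}$. A group is free-by-cyclic if it admits a surjection onto $\mathbb{Z}$ with free kernel (possibly of infinite rank); it is $F_n$-by-$\mathbb{Z}$ if it admits a surjection onto $\mathbb{Z}$ whose kernel is free of finite rank $n$. A group virtually has a property if some finite-index subgroup has it. *)

theory Defs
  imports "HOL-Algebra.Elementary_Groups" "Graph_Theory.Digraph_Component"
begin

section \<open>Presentations and free groups\<close>

text \<open>A letter \<open>(x, True)\<close> stands for the generator \<open>x\<close> and \<open>(x, False)\<close> for its inverse.\<close>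

type_synonym 'x word = "('x \<times> bool) list"

definition words :: "'x set \<Rightarrow> 'x word set"
  where "words X = lists (X \<times> UNIV)"

inductive_set presentation_rel :: "'x set \<Rightarrow> 'x word set \<Rightarrow> ('x word \<times> 'x word) set"
  for X :: "'x set" and R :: "'x word set"
  where
    refl: "w \<in> words X \<Longrightarrow> (w, w) \<in> presentation_rel X R"
  | sym: "(u, w) \<in> presentation_rel X R \<Longrightarrow> (w, u) \<in> presentation_rel X R"
  | trans: "\<lbrakk>(u, v) \<in> presentation_rel X R; (v, w) \<in> presentation_rel X R\<rbrakk>
      \<Longrightarrow> (u, w) \<in> presentation_rel X R"
  | cancel: "\<lbrakk>u \<in> words X; w \<in> words X; x \<in> X\<rbrakk>
      \<Longrightarrow> (u @ [(x, b), (x, \<not> b)] @ w, u @ w) \<in> presentation_rel X R"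
  | relator: "\<lbrakk>u \<in> words X; w \<in> words X; r \<in> R; r \<in> words X\<rbrakk>
      \<Longrightarrow> (u @ r @ w, u @ w) \<in> presentation_rel X R"

definition presented_group :: "'x set \<Rightarrow> 'x word set \<Rightarrow> 'x word set monoid"
  where "presented_group X R =
    \<lparr>carrier = words X // presentation_rel X R,
     monoid.mult = (\<lambda>A B. \<Union>a\<in>A. \<Union>b\<in>B. presentation_rel X R `` {a @ b}),
     one = presentation_rel X R `` {[]}\<rparr>"

definition free_group :: "'x set \<Rightarrow> 'x word set monoid"
  where "free_group X = presented_group X {}"

text \<open>A free basis may always be chosen inside the group, so in \<open>is_free\<close> it suffices to let \<open>X\<close>
  range over sets of elements of the group's own type.\<close>

definition is_free :: "'g monoid \<Rightarrow> bool"
  where "is_free G \<longleftrightarrow> (\<exists>X :: 'g set. G \<cong> free_group X)"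

definition is_free_of_rank :: "nat \<Rightarrow> 'g monoid \<Rightarrow> bool"
  where "is_free_of_rank n G \<longleftrightarrow> G \<cong> free_group {..<n}"


section \<open>Free-by-cyclic groups and virtual properties\<close>

definition free_by_cyclic :: "'g monoid \<Rightarrow> bool"
  where "free_by_cyclic G \<longleftrightarrow>
    (\<exists>f \<in> epi G integer_group. is_free (G\<lparr>carrier := kernel G integer_group f\<rparr>))"

definition Fn_by_Z :: "nat \<Rightarrow> 'g monoid \<Rightarrow> bool"
  where "Fn_by_Z n G \<longleftrightarrow>
    (\<exists>f \<in> epi G integer_group. is_free_of_rank n (G\<lparr>carrier := kernel G integer_group f\<rparr>))"

definition virtually :: "('g monoid \<Rightarrow> bool) \<Rightarrow> 'g monoid \<Rightarrow> bool"
  where "virtually P G \<longleftrightarrow>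
    (\<exists>H. subgroup H G \<and> finite (rcosets\<^bsub>G\<^esub> H) \<and> P (G\<lparr>carrier := H\<rparr>))"


section \<open>Graphs of groups\<close>

text \<open>Arcs carry an arbitrary orientation; loops and parallel arcs are allowed.\<close>

record ('v, 'e, 'a, 'b) graph_of_groups =
  graph :: "('v, 'e) pre_digraph"
  vertex_group :: "'v \<Rightarrow> 'a monoid"
  edge_group :: "'e \<Rightarrow> 'b monoid"
  tail_map :: "'e \<Rightarrow> 'b \<Rightarrow> 'a"
  head_map :: "'e \<Rightarrow> 'b \<Rightarrow> 'a"

locale graph_of_groups =
  fixes \<G> :: "('v, 'e, 'a, 'b) graph_of_groups"
  assumes graph_wf: "wf_digraph (graph \<G>)"
    and graph_connected: "Digraph_Component.connected (graph \<G>)"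
    and vertex_group_is_group: "v \<in> verts (graph \<G>) \<Longrightarrow> group (vertex_group \<G> v)"
    and edge_group_is_group: "e \<in> arcs (graph \<G>) \<Longrightarrow> group (edge_group \<G> e)"
    and tail_map_mon: "e \<in> arcs (graph \<G>) \<Longrightarrow>
      tail_map \<G> e \<in> mon (edge_group \<G> e) (vertex_group \<G> (tail (graph \<G>) e))"
    and head_map_mon: "e \<in> arcs (graph \<G>) \<Longrightarrow>
      head_map \<G> e \<in> mon (edge_group \<G> e) (vertex_group \<G> (head (graph \<G>) e))"

datatype ('v, 'e, 'a) gog_generator = Vertex_Elt 'v 'a | Stable_Letter 'e

definition gog_generators ::
  "('v, 'e, 'a, 'b) graph_of_groups \<Rightarrow> ('v, 'e, 'a) gog_generator set"
  where "gog_generators \<G> =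
    {Vertex_Elt v a | v a. v \<in> verts (graph \<G>) \<and> a \<in> carrier (vertex_group \<G> v)}
    \<union> Stable_Letter ` arcs (graph \<G>)"

text \<open>The relators are the multiplication tables of the vertex groups, and
  \<open>t\<^sub>e \<cdot> head_map e c \<cdot> t\<^sub>e\<inverse> = tail_map e c\<close> for each arc \<open>e\<close>
  and each \<open>c\<close> in its edge group.\<close>

definition gog_relators ::
  "('v, 'e, 'a, 'b) graph_of_groups \<Rightarrow> ('v, 'e, 'a) gog_generator word set"
  where "gog_relators \<G> =
    {[(Vertex_Elt v a, True), (Vertex_Elt v b, True),
      (Vertex_Elt v (a \<otimes>\<^bsub>vertex_group \<G> v\<^esub> b), False)] | v a b.
      v \<in> verts (graph \<G>) \<and> a \<in> carrier (vertex_group \<G> v) \<and> b \<in> carrier (vertex_group \<G> v)}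
    \<union> {[(Stable_Letter e, True), (Vertex_Elt (head (graph \<G>) e) (head_map \<G> e c), True),
        (Stable_Letter e, False), (Vertex_Elt (tail (graph \<G>) e) (tail_map \<G> e c), False)] | e c.
      e \<in> arcs (graph \<G>) \<and> c \<in> carrier (edge_group \<G> e)}"

text \<open>Words spelled along edge paths. The stable letter of an arc crosses it from tail to head,
  its inverse from head to tail.\<close>

inductive gog_path ::
  "('v, 'e, 'a, 'b) graph_of_groups \<Rightarrow> 'v \<Rightarrow> ('v, 'e, 'a) gog_generator word \<Rightarrow> 'v \<Rightarrow> bool"
  for \<G> :: "('v, 'e, 'a, 'b) graph_of_groups"
  where
    Nil: "v \<in> verts (graph \<G>) \<Longrightarrow> gog_path \<G> v [] v"
  | Vertex: "\<lbrakk>a \<in> carrier (vertex_group \<G> v); gog_path \<G> v p w\<rbrakk>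
      \<Longrightarrow> gog_path \<G> v ((Vertex_Elt v a, True) # p) w"
  | Forward: "\<lbrakk>e \<in> arcs (graph \<G>); gog_path \<G> (head (graph \<G>) e) p w\<rbrakk>
      \<Longrightarrow> gog_path \<G> (tail (graph \<G>) e) ((Stable_Letter e, True) # p) w"
  | Backward: "\<lbrakk>e \<in> arcs (graph \<G>); gog_path \<G> (tail (graph \<G>) e) p w\<rbrakk>
      \<Longrightarrow> gog_path \<G> (head (graph \<G>) e) ((Stable_Letter e, False) # p) w"

text \<open>The fundamental group \<open>\<pi>\<^sub>1(\<G>, v)\<close> in Serre's form based at a vertex: the subgroup of
  the group presented by the generators and relators above whose elements are represented by
  closed paths at \<open>v\<close>.\<close>

definition gog_fundamental_group :: "('v, 'e, 'a, 'b) graph_of_groups \<Rightarrow> 'v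
    \<Rightarrow> ('v, 'e, 'a) gog_generator word set monoid"
  where "gog_fundamental_group \<G> v =
    (presented_group (gog_generators \<G>) (gog_relators \<G>))
      \<lparr>carrier := {presentation_rel (gog_generators \<G>) (gog_relators \<G>) `` {p} | p.
        gog_path \<G> v p v}\<rparr>"


section \<open>Tubular groups\<close>

text \<open>\<open>G\<close> splits as the finite graph of groups \<open>\<G>\<close>, all vertex groups being isomorphic
  to \<open>\<int>\<^sup>2\<close> and all edge groups to \<open>\<int>\<close>. A group is tubular if it has such
  a splitting. HOL cannot existentially quantify the types in which the graph and its vertex and
  edge groups live, so the splitting is an argument of the predicate.\<close>

definition tubular_splitting :: "'g monoid \<Rightarrow> ('v, 'e, 'a, 'b) graph_of_groups \<Rightarrow> bool"
  where "tubular_splitting G \<G> \<longleftrightarrow>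
    graph_of_groups \<G> \<and> fin_digraph (graph \<G>) \<and>
    (\<forall>v \<in> verts (graph \<G>). vertex_group \<G> v \<cong> integer_group \<times>\<times> integer_group) \<and>
    (\<forall>e \<in> arcs (graph \<G>). edge_group \<G> e \<cong> integer_group) \<and>
    (\<exists>v \<in> verts (graph \<G>). G \<cong> gog_fundamental_group \<G> v)"

end

theory Submission
  imports Defs Complex_Main "HOL-Library.Sublist" "HOL-Library.Product_Plus"
begin

text \<open>
  Both claims are instances of one: if a subgroup \<open>H\<close> of finite index in a tubular group \<open>G\<close> has an
  epimorphism \<open>f\<close> to \<open>\<int>\<close> with free kernel \<open>K\<close>, then \<open>K\<close> is finitely generated, so that the very same
  \<open>f\<close> shows \<open>H\<close> to be \<open>F\<^sub>n\<close>-by-\<open>\<int>\<close>. Taking \<open>H = G\<close> gives the first claim.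

  The reason is that \<open>f\<close> cannot kill an edge group. A free group has no two independent commuting
  elements (\<open>free_group_commuting_dependent\<close>). As vertex groups are copies of \<open>\<int>\<^sup>2\<close>, \<open>f\<close> is therefore
  nonzero on every conjugate of every vertex group, intersected with \<open>H\<close>
  (\<open>vertex_group_not_killed\<close>). Now suppose that \<open>f\<close> kills (the part in \<open>H\<close> of) an edge group \<open>\<langle>c\<rangle>\<close>. Choose
  \<open>x\<close> and \<open>y\<close> in the vertex groups at the two ends of that edge with \<open>f x = f y \<noteq> 0\<close>. Then \<open>x y\<inverse>\<close> is in \<open>K\<close>
  and commutes with \<open>c\<close>, so the two must be dependent. That they are independent in \<open>G\<close> can be read
  off from normal forms, but it is simpler to exhibit a representation: tubular groups have plenty of
  actions on the plane in which vertex groups act by translations and stable letters by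
  real-linear maps, and one can choose such an action in which \<open>x y\<inverse>\<close> is the translation by \<open>2 x\<close>,
  which is not parallel to \<open>c\<close> (\<open>plane_representation_at_edge\<close>, \<open>edge_group_not_killed\<close>). The same
  representations show that vertex groups embed.

  Since \<open>f\<close> is nonzero on the edge stabilizers in \<open>H\<close> of the Bass--Serre tree, the image of each of them has
  finite index in \<open>\<int>\<close>, so that \<open>K\<close> has only finitely many orbits of edges (\<open>edge_orbits\<close>). Vertex
  stabilizers in \<open>K\<close> are finitely generated, being subgroups of \<open>\<int>\<^sup>2\<close>. A group acting on a
  connected graph in this way is finitely generated (\<open>finitely_generated_of_cocompact_action\<close>), and a
  finitely generated free group has finite rank.
\<close>

section \<open>Groups given by generators and relators\<close>

abbreviation word_class :: "'x set \<Rightarrow> 'x word set \<Rightarrow> 'x word \<Rightarrow> 'x word set"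
  where "word_class X R w \<equiv> presentation_rel X R `` {w}"

definition inv_word :: "'x word \<Rightarrow> 'x word"
  where "inv_word w = rev (map (\<lambda>(x, b). (x, \<not> b)) w)"

lemma inv_word_simps [simp]:
  "inv_word [] = []"
  "inv_word ((x, b) # w) = inv_word w @ [(x, \<not> b)]"
  "inv_word (u @ w) = inv_word w @ inv_word u"
  "inv_word (inv_word w) = w"
  "length (inv_word w) = length w"
  by (auto simp: inv_word_def rev_map comp_def case_prod_beta)

lemma words_simps [simp]:
  "[] \<in> words X"
  "(x, b) # w \<in> words X \<longleftrightarrow> x \<in> X \<and> w \<in> words X"
  "u @ w \<in> words X \<longleftrightarrow> u \<in> words X \<and> w \<in> words X"
  by (auto simp: words_def)

lemma inv_word_in_words [simp]: "inv_word w \<in> words X \<longleftrightarrow> w \<in> words X"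
  by (induction w) auto

lemma presentation_rel_words:
  assumes "(u, w) \<in> presentation_rel X R"
  shows "u \<in> words X \<and> w \<in> words X"
  using assms by induction auto

lemma equiv_presentation_rel: "equiv (words X) (presentation_rel X R)"
proof (rule equivI)
  show "presentation_rel X R \<subseteq> words X \<times> words X"
    using presentation_rel_words by fast
  show "refl_on (words X) (presentation_rel X R)"
    using presentation_rel.refl by (fastforce intro!: refl_onI)
  show "Relation.sym (presentation_rel X R)"
    by (meson presentation_rel.sym symI)
  show "Relation.trans (presentation_rel X R)"
    by (meson presentation_rel.trans transI)
qed

lemma presentation_rel_prepend:
  assumes "(u, w) \<in> presentation_rel X R" and "v \<in> words X"
  shows "(v @ u, v @ w) \<in> presentation_rel X R"
  using assms
proof induction
  case (cancel u w x b)
  then show ?case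
    using presentation_rel.cancel[of "v @ u" X w x b R] by simp
next
  case (relator u w r)
  then show ?case
    using presentation_rel.relator[of "v @ u" X w r R] by simp
qed (auto intro: presentation_rel.intros)

lemma presentation_rel_append:
  assumes "(u, w) \<in> presentation_rel X R" and "v \<in> words X"
  shows "(u @ v, w @ v) \<in> presentation_rel X R"
  using assms
proof induction
  case (cancel u w x b)
  then show ?case
    using presentation_rel.cancel[of u X "w @ v" x b R] by simp
next
  case (relator u w r)
  then show ?case
    using presentation_rel.relator[of u X "w @ v" r R] by simp
qed (auto intro: presentation_rel.intros)

lemma word_class_eq_iff:
  assumes "u \<in> words X" "w \<in> words X"
  shows "word_class X R u = word_class X R w \<longleftrightarrow> (u, w) \<in> presentation_rel X R"
  using eq_equiv_class_iff[OF equiv_presentation_rel] assms by metis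

lemma presentation_rel_append_cong:
  assumes "(u, u') \<in> presentation_rel X R" "(w, w') \<in> presentation_rel X R"
  shows "(u @ w, u' @ w') \<in> presentation_rel X R"
  by (meson assms presentation_rel.trans presentation_rel_append presentation_rel_prepend
      presentation_rel_words)

lemma carrier_presented_group:
  "carrier (presented_group X R) = word_class X R ` words X"
  by (auto simp: presented_group_def quotient_def)

lemma one_presented_group: "\<one>\<^bsub>presented_group X R\<^esub> = word_class X R []"
  by (simp add: presented_group_def)

lemma mult_presented_group:
  assumes "u \<in> words X" "w \<in> words X"
  shows "word_class X R u \<otimes>\<^bsub>presented_group X R\<^esub> word_class X R w = word_class X R (u @ w)"
proof -
  have "word_class X R (a @ b) = word_class X R (u @ w)"
    if "(u, a) \<in> presentation_rel X R" "(w, b) \<in> presentation_rel X R" for a b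
    using equiv_class_eq[OF equiv_presentation_rel presentation_rel_append_cong[OF that]] by simp
  moreover have "(u, u) \<in> presentation_rel X R" "(w, w) \<in> presentation_rel X R"
    using assms presentation_rel.refl by auto
  ultimately have "(\<Union>a\<in>word_class X R u. \<Union>b\<in>word_class X R w. word_class X R (a @ b))
      = word_class X R (u @ w)"
    by blast
  then show ?thesis
    by (simp add: presented_group_def)
qed

lemma inv_word_cancel:
  assumes "w \<in> words X"
  shows "(inv_word w @ w, []) \<in> presentation_rel X R"
  using assms
proof (induction w)
  case (Cons p w)
  obtain x b where p: "p = (x, b)"
    by fastforce
  have "(inv_word w @ [(x, \<not> b), (x, \<not> \<not> b)] @ w, inv_word w @ w) \<in> presentation_rel X R"
    using Cons.prems p by (intro presentation_rel.cancel) auto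
  then show ?case
    using Cons p by (auto intro: presentation_rel.trans)
qed (auto intro: presentation_rel.refl)

lemma group_presented_group: "group (presented_group X R)"
proof (rule groupI)
  fix A assume "A \<in> carrier (presented_group X R)"
  then obtain w where w: "w \<in> words X" "A = word_class X R w"
    by (auto simp: carrier_presented_group)
  have "word_class X R (inv_word w) \<otimes>\<^bsub>presented_group X R\<^esub> A = \<one>\<^bsub>presented_group X R\<^esub>"
    using w inv_word_cancel[of w X R]
    by (simp add: mult_presented_group one_presented_group word_class_eq_iff)
  moreover have "word_class X R (inv_word w) \<in> carrier (presented_group X R)"
    using w by (simp add: carrier_presented_group)
  ultimately show "\<exists>B\<in>carrier (presented_group X R). B \<otimes>\<^bsub>presented_group X R\<^esub> A = \<one>\<^bsub>presented_group X R\<^esub>"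
    by blast
qed (auto simp: carrier_presented_group mult_presented_group one_presented_group)

lemma inv_presented_group:
  assumes "w \<in> words X"
  shows "inv\<^bsub>presented_group X R\<^esub> word_class X R w = word_class X R (inv_word w)"
proof (rule group.inv_equality[OF group_presented_group])
  show "word_class X R (inv_word w) \<otimes>\<^bsub>presented_group X R\<^esub> word_class X R w = \<one>\<^bsub>presented_group X R\<^esub>"
    using assms inv_word_cancel[of w X R]
    by (simp add: mult_presented_group one_presented_group word_class_eq_iff)
qed (use assms in \<open>simp_all add: carrier_presented_group\<close>)

fun word_eval :: "('g, 'm) monoid_scheme \<Rightarrow> ('x \<Rightarrow> 'g) \<Rightarrow> 'x word \<Rightarrow> 'g"
  where
    "word_eval T \<phi> [] = \<one>\<^bsub>T\<^esub>"
  | "word_eval T \<phi> ((x, b) # w) = (if b then \<phi> x else inv\<^bsub>T\<^esub> \<phi> x) \<otimes>\<^bsub>T\<^esub> word_eval T \<phi> w"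

context group
begin

lemma word_eval_closed [simp]:
  "\<phi> \<in> X \<rightarrow> carrier G \<Longrightarrow> w \<in> words X \<Longrightarrow> word_eval G \<phi> w \<in> carrier G"
  by (induction w) (auto simp: Pi_iff)

lemma word_eval_append:
  "\<phi> \<in> X \<rightarrow> carrier G \<Longrightarrow> u \<in> words X \<Longrightarrow> w \<in> words X \<Longrightarrow>
    word_eval G \<phi> (u @ w) = word_eval G \<phi> u \<otimes> word_eval G \<phi> w"
  by (induction u) (auto simp: m_assoc Pi_iff)

lemma word_eval_respects:
  assumes "(u, w) \<in> presentation_rel X R" and \<phi>: "\<phi> \<in> X \<rightarrow> carrier G"
    and rel: "\<And>r. r \<in> R \<Longrightarrow> r \<in> words X \<Longrightarrow> word_eval G \<phi> r = \<one>"
  shows "word_eval G \<phi> u = word_eval G \<phi> w"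
  using assms(1)
proof induction
  case (cancel u w x b)
  then have "\<phi> x \<in> carrier G"
    using \<phi> by auto
  moreover have "word_eval G \<phi> w \<in> carrier G"
    using cancel \<phi> by simp
  ultimately have "word_eval G \<phi> ([(x, b), (x, \<not> b)] @ w) = word_eval G \<phi> w"
    by (auto simp: m_assoc[symmetric])
  then show ?case
    using cancel \<phi> by (simp add: word_eval_append)
next
  case (relator u w r)
  then show ?case
    using \<phi> rel by (simp add: word_eval_append)
qed auto

text \<open>The universal property of a presentation: homomorphisms out of a presented group are
  assignments of the generators that satisfy the relators.\<close>

lemma presented_group_lift:
  assumes \<phi>: "\<phi> \<in> X \<rightarrow> carrier G"
    and rel: "\<And>r. r \<in> R \<Longrightarrow> r \<in> words X \<Longrightarrow> word_eval G \<phi> r = \<one>"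
  obtains h where "h \<in> hom (presented_group X R) G"
    and "\<And>w. w \<in> words X \<Longrightarrow> h (word_class X R w) = word_eval G \<phi> w"
proof
  define h where "h A = word_eval G \<phi> (SOME w. w \<in> A)" for A
  show h: "h (word_class X R w) = word_eval G \<phi> w" if "w \<in> words X" for w
  proof -
    have "w \<in> word_class X R w"
      using that presentation_rel.refl by auto
    then have "(w, SOME u. u \<in> word_class X R w) \<in> presentation_rel X R"
      by (metis Image_singleton_iff someI_ex)
    then show ?thesis
      using word_eval_respects[OF _ \<phi> rel] unfolding h_def by metis
  qed
  show "h \<in> hom (presented_group X R) G"
    using \<phi> by (intro homI)
      (auto simp: carrier_presented_group mult_presented_group h word_eval_append)
qed

end

section \<open>Reduced words\<close>

definition reduced :: "'x word \<Rightarrow> bool"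
  where "reduced = successively (\<lambda>p q. q \<noteq> (fst p, \<not> snd p))"

fun push_letter :: "'x \<times> bool \<Rightarrow> 'x word \<Rightarrow> 'x word"
  where
    "push_letter p [] = [p]"
  | "push_letter p (q # w) = (if q = (fst p, \<not> snd p) then w else p # q # w)"

text \<open>Pushing the letters one by one onto a stack, with cancellation at its top, is the action of the
  free group on its reduced words. Since every letter acts by a bijection
  (\<open>push_letter_cancel\<close>), the result depends only on the element that the word represents, which
  is why an element has just one reduced word.\<close>

definition reduce :: "'x word \<Rightarrow> 'x word"
  where "reduce w = foldr push_letter w []"

lemma reduced_simps [simp]:
  "reduced []" "reduced [p]"
  "reduced (p # q # w) \<longleftrightarrow> q \<noteq> (fst p, \<not> snd p) \<and> reduced (q # w)"
  by (auto simp: reduced_def)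

lemma reduced_push_letter: "reduced w \<Longrightarrow> reduced (push_letter p w)"
  by (cases w; cases "tl w") auto

lemma reduced_foldr_push: "reduced v \<Longrightarrow> reduced (foldr push_letter w v)"
  by (induction w) (auto intro: reduced_push_letter)

lemma reduced_reduce [simp]: "reduced (reduce w)"
  by (simp add: reduce_def reduced_foldr_push)

lemma reduce_id: "reduced w \<Longrightarrow> reduce w = w"
proof (induction w)
  case (Cons p w)
  then show ?case
    by (cases w) (auto simp: reduce_def)
qed (simp add: reduce_def)

lemma push_letter_cancel: "reduced w \<Longrightarrow> push_letter (x, b) (push_letter (x, \<not> b) w) = w"
  by (cases w; cases "tl w") auto

lemma reduce_respects:
  "(u, w) \<in> presentation_rel X {} \<Longrightarrow> reduce u = reduce w"
proof (induction rule: presentation_rel.induct)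
  case (cancel u w x b)
  have "reduced (foldr push_letter w [])"
    by (simp add: reduced_foldr_push)
  then show ?case
    by (simp add: reduce_def push_letter_cancel)
qed auto

lemma push_letter_rel:
  assumes "p # w \<in> words X"
  shows "(p # w, push_letter p w) \<in> presentation_rel X R"
proof (cases w)
  case (Cons q v)
  obtain x b where p: "p = (x, b)"
    by fastforce
  have "([] @ [(x, b), (x, \<not> b)] @ v, [] @ v) \<in> presentation_rel X R"
    using assms Cons p by (intro presentation_rel.cancel) (cases q, auto)+
  then show ?thesis
    using assms Cons p by (auto intro: presentation_rel.refl)
qed (use assms in \<open>auto intro: presentation_rel.refl\<close>)

lemma reduce_rel:
  "w \<in> words X \<Longrightarrow> (w, reduce w) \<in> presentation_rel X R"
proof (induction w)
  case (Cons p w)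
  have p: "[p] \<in> words X" and w: "w \<in> words X"
    using Cons.prems by (cases p, auto)+
  have *: "(p # w, p # reduce w) \<in> presentation_rel X R"
    using presentation_rel_prepend[OF Cons.IH[OF w] p] by simp
  with push_letter_rel[of p "reduce w" X R] presentation_rel_words[OF *] show ?case
    by (auto simp: reduce_def intro: presentation_rel.trans)
qed (auto simp: reduce_def intro: presentation_rel.refl)

lemma reduce_in_words: "w \<in> words X \<Longrightarrow> reduce w \<in> words X"
  using reduce_rel presentation_rel_words by metis

section \<open>Commuting elements in groups with a tree-like length\<close>

lemma int_arith_progression_bounded_below_const:
  fixes g :: "int \<Rightarrow> int"
  assumes step: "\<And>n. g (n + 1) + g (n - 1) = 2 * g n" and nonneg: "\<And>n. g n \<ge> 0"
  shows "g n = g 0"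
proof -
  define d where "d = g 1 - g 0"
  have inc: "g (int k) = g 0 + int k * d \<and> g (int k + 1) = g 0 + (int k + 1) * d" for k
  proof (induction k)
    case (Suc k)
    then show ?case
      using step[of "int k + 1"] by (simp add: algebra_simps)
  qed (simp add: d_def)
  have dec: "g (- int k) = g 0 - int k * d \<and> g (- int k - 1) = g 0 - (int k + 1) * d" for k
  proof (induction k)
    case 0
    then show ?case
      using step[of 0] by (simp add: d_def)
  next
    case (Suc k)
    have e: "- int (Suc k) = - int k - 1"
      by simp
    show ?case
      unfolding e using Suc step[of "- int k - 1"] by (simp add: algebra_simps)
  qed
  have "d = 0"
  proof (rule ccontr)
    assume "d \<noteq> 0"
    define k where "k = nat (g 0 + 1)"
    have k: "int k = g 0 + 1"
      using nonneg[of 0] by (simp add: k_def)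
    have "int k \<le> \<bar>int k * d\<bar>"
      using \<open>d \<noteq> 0\<close> mult_left_mono[of 1 "\<bar>d\<bar>" "int k"] by (simp add: abs_mult)
    moreover have "g 0 + int k * d \<ge> 0" "g 0 - int k * d \<ge> 0"
      using nonneg[of "int k"] nonneg[of "- int k"] inc[of k] dec[of k] by auto
    ultimately show False
      using k by arith
  qed
  then show ?thesis
    using inc[of "nat n"] dec[of "nat (- n)"] by (cases "n \<ge> 0") auto
qed

lemma finite_set_imp_int_collision:
  fixes F :: "int \<Rightarrow> 'b"
  assumes "finite A" and "\<And>n. F n \<in> A"
  obtains m n where "m \<noteq> n" "F m = F n"
proof -
  have "finite (range F)"
    using assms by (meson finite_subset image_subsetI)
  then have "\<not> inj F"
    using finite_imageD infinite_UNIV_int by blast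
  then show ?thesis
    using that unfolding inj_def by blast
qed

context group
begin

text \<open>\<open>(i, j) \<mapsto> a\<^sup>i b\<^sup>j\<close> is a homomorphism from \<open>\<int>\<^sup>2\<close>.\<close>

lemma commuting_int_pow_mult:
  assumes "a \<in> carrier G" "b \<in> carrier G" "a \<otimes> b = b \<otimes> a"
  shows "(a [^] (i::int) \<otimes> b [^] (j::int)) \<otimes> (a [^] (k::int) \<otimes> b [^] (l::int))
    = a [^] (i + k) \<otimes> b [^] (j + l)"
proof -
  have nat: "b \<otimes> a [^] (n::nat) = a [^] n \<otimes> b" if "a \<in> carrier G" "b \<in> carrier G" "a \<otimes> b = b \<otimes> a"
    for a b n
  proof (induction n)
    case (Suc n)
    have "b \<otimes> a [^] Suc n = (b \<otimes> a [^] n) \<otimes> a"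
      using that by (simp add: m_assoc)
    also have "\<dots> = a [^] n \<otimes> (b \<otimes> a)"
      using that Suc by (simp add: m_assoc)
    finally show ?case
      using that by (simp add: m_assoc)
  qed (use that in simp)
  have int: "b \<otimes> a [^] (n::int) = a [^] n \<otimes> b"
    if a: "a \<in> carrier G" and b: "b \<in> carrier G" and ab: "a \<otimes> b = b \<otimes> a" for a b n
  proof (cases "n \<ge> 0")
    case True
    then show ?thesis
      using nat[OF a b ab, of "nat n"] by (simp add: int_pow_def2 del: pow_nat)
  next
    case False
    have "inv a \<otimes> b = b \<otimes> inv a"
    proof -
      have "inv a \<otimes> b = inv a \<otimes> (b \<otimes> a) \<otimes> inv a"
        using a b by (simp add: m_assoc)
      also have "\<dots> = b \<otimes> inv a"
        using a b by (simp add: ab[symmetric] m_assoc[symmetric])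
      finally show ?thesis .
    qed
    then show ?thesis
      using nat[of "inv a" b "nat (- n)"] False a b by (simp add: int_pow_def2 nat_pow_inv del: pow_nat)
  qed
  have "b [^] j \<otimes> a [^] k = a [^] k \<otimes> b [^] j"
    using int[of a "b [^] j" k] int[of b a j] assms by simp
  then have "(a [^] i \<otimes> b [^] j) \<otimes> (a [^] k \<otimes> b [^] l) = a [^] i \<otimes> (a [^] k \<otimes> b [^] j) \<otimes> b [^] l"
    using assms by (metis int_pow_closed m_assoc m_closed)
  then show ?thesis
    using assms by (simp add: int_pow_mult m_assoc)
qed

lemma commuting_dependent_of_collision:
  assumes "a \<in> carrier G" "b \<in> carrier G" "a \<otimes> b = b \<otimes> a"
    and "(i::int, j::int) \<noteq> (k, l)" "a [^] i \<otimes> b [^] j = a [^] k \<otimes> b [^] l"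
  shows "\<exists>(m::int) (n::int). (m, n) \<noteq> (0, 0) \<and> a [^] m \<otimes> b [^] n = \<one>"
proof -
  have "(a [^] i \<otimes> b [^] j) \<otimes> (a [^] (- k) \<otimes> b [^] (- l)) = \<one>"
    using commuting_int_pow_mult[OF assms(1-3), of k l "- k" "- l"] assms(5) by simp
  then have "a [^] (i - k) \<otimes> b [^] (j - l) = \<one>"
    using commuting_int_pow_mult[OF assms(1-3), of i j "- k" "- l"] by simp
  moreover have "(i - k, j - l) \<noteq> (0, 0)"
    using assms(4) by auto
  ultimately show ?thesis
    by blast
qed

text \<open>No two commuting elements are independent in a group whose length function comes from a locally
  finite tree: \<open>len x\<close> is then the distance from a base point to its image under \<open>x\<close>, twice the
  Gromov product is \<open>len x + len y - len (inv x \<otimes> y)\<close>, and in a tree the Gromov product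
  satisfies the ultrametric inequality.

  For commuting \<open>x\<close> and \<open>b\<close> the points \<open>1\<close>, \<open>x\<close>, \<open>b\<close>, \<open>x b\<close> span a parallelogram with sides \<open>len x\<close>
  and \<open>len b\<close>. If \<open>len x > len b\<close>, the ultrametric inequality forces the diagonals \<open>len (x b)\<close> and
  \<open>len (inv x b)\<close> to sum to \<open>2 len x\<close>. So if \<open>len (a\<^sup>i b\<^sup>j) > len b\<close> for a fixed \<open>i\<close> and all integers
  \<open>j\<close>, then \<open>j \<mapsto> len (a\<^sup>i b\<^sup>j)\<close> is an arithmetic progression on \<open>\<int>\<close> that is bounded below, hence it
  is constant, and two of the elements \<open>a\<^sup>i b\<^sup>j\<close> coincide because balls are finite. If there is no
  such \<open>i\<close>, then every \<open>i\<close> has some \<open>j\<close> with \<open>len (a\<^sup>i b\<^sup>j) \<le> len b\<close>, and again two of these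
  infinitely many exponents give the same element.\<close>

lemma commuting_dependent_of_tree_length:
  fixes len :: "'a \<Rightarrow> nat"
  defines "gp \<equiv> \<lambda>x y. int (len x) + int (len y) - int (len (inv x \<otimes> y))"
  assumes a: "a \<in> carrier G" and b: "b \<in> carrier G" and comm: "a \<otimes> b = b \<otimes> a"
    and len_inv: "\<And>x. x \<in> carrier G \<Longrightarrow> len (inv x) = len x"
    and ultrametric: "\<And>x y z. x \<in> carrier G \<Longrightarrow> y \<in> carrier G \<Longrightarrow> z \<in> carrier G \<Longrightarrow>
      min (gp x y) (gp y z) \<le> gp x z"
    and proper: "\<And>n. finite {x. (\<exists>(i::int) (j::int). x = a [^] i \<otimes> b [^] j) \<and> len x \<le> n}"
  shows "\<exists>(i::int) (j::int). (i, j) \<noteq> (0, 0) \<and> a [^] i \<otimes> b [^] j = \<one>"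
proof -
  define e where "e i j = a [^] i \<otimes> b [^] j" for i j :: int
  have e_closed [simp]: "e i j \<in> carrier G" for i j
    using a b by (simp add: e_def)
  have e_mult [simp]: "e i j \<otimes> e k l = e (i + k) (j + l)" for i j k l
    unfolding e_def using commuting_int_pow_mult[OF a b comm] .
  have e_inv [simp]: "inv (e i j) = e (- i) (- j)" for i j
    by (rule inv_equality) (simp_all, simp add: e_def)
  have len_neg: "len (e (- i) (- j)) = len (e i j)" for i j
    using len_inv[of "e i j"] by simp
  have midpoint: "int (len (e i (j + 1))) + int (len (e i (j - 1))) = 2 * int (len (e i j))"
    if "len (e i j) > len (e 0 1)" for i j
  proof -
    let ?x = "e i j" and ?y = "e 0 1" and ?z = "e i (j + 1)"
    have len: "len (inv ?x \<otimes> ?y) = len (e i (j - 1))" "len (inv ?x \<otimes> ?z) = len ?y"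
      "len (inv ?y \<otimes> ?z) = len ?x" "len (inv ?y \<otimes> ?x) = len (e i (j - 1))"
      "len (inv ?z \<otimes> ?y) = len ?x" "len (inv ?z \<otimes> ?x) = len ?y"
      using len_neg[of i "j - 1"] len_neg[of i j] len_neg[of 0 1] by (simp_all add: algebra_simps)
    show ?thesis
      using ultrametric[of ?y ?x ?z] ultrametric[of ?x ?z ?y] that len
      unfolding gp_def by (auto simp: min_def split: if_splits)
  qed
  have collision: ?thesis if "(i, j) \<noteq> (k, l)" "e i j = e k l" for i j k l
    using commuting_dependent_of_collision[OF a b comm] that unfolding e_def by blast
  have bounded_collision: ?thesis if "\<And>k. len (e (p k) (q k)) \<le> n" "inj (\<lambda>k. (p k, q k))"
    for p q :: "int \<Rightarrow> int" and n
  proof -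
    have mem: "e (p k) (q k) \<in> {x. (\<exists>(i::int) (j::int). x = a [^] i \<otimes> b [^] j) \<and> len x \<le> n}" for k
      using that(1) e_def by blast
    obtain k l where "k \<noteq> l" "e (p k) (q k) = e (p l) (q l)"
      by (rule finite_set_imp_int_collision[OF proper[of n], where F = "\<lambda>k. e (p k) (q k)", OF mem])
    moreover from this have "(p k, q k) \<noteq> (p l, q l)"
      using that(2) by (auto dest: injD)
    ultimately show ?thesis
      using collision[of "p k" "q k" "p l" "q l"] by simp
  qed
  show ?thesis
  proof (cases "\<exists>i. \<forall>j. len (e i j) > len (e 0 1)")
    case True
    then obtain i where i: "\<And>j. len (e i j) > len (e 0 1)"
      by blast
    have "int (len (e i j)) = int (len (e i 0))" for j
      using midpoint[OF i]
      by (intro int_arith_progression_bounded_below_const[of "\<lambda>j. int (len (e i j))"]) auto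
    then have "len (e i j) \<le> len (e i 0)" for j
      by (metis of_nat_eq_iff order_refl)
    then show ?thesis
      by (intro bounded_collision[of "\<lambda>_. i" "\<lambda>j. j" "len (e i 0)"]) (simp_all add: inj_def)
  next
    case False
    then obtain q where "\<And>i. len (e i (q i)) \<le> len (e 0 1)"
      by (metis not_less)
    then show ?thesis
      by (intro bounded_collision[of "\<lambda>i. i" q]) (auto simp: inj_def)
  qed
qed

end

section \<open>Commuting elements of free groups\<close>

lemma reduced_inv_word: "reduced (inv_word w) \<longleftrightarrow> reduced w"
  unfolding reduced_def inv_word_def successively_rev successively_map
  by (rule arg_cong[where f = "\<lambda>P. successively P w"]) (auto simp: fun_eq_iff)

text \<open>After removal of the common prefix nothing cancels any more. So the Gromov product for the word
  length is the length of the common prefix of the reduced words.\<close>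

lemma reduce_append_inv:
  assumes u: "reduced u" "u \<in> words X" and v: "reduced v" "v \<in> words X"
  defines "p \<equiv> longest_common_prefix u v"
  shows "length (reduce (inv_word u @ v)) + 2 * length p = length u + length v"
proof -
  obtain u' where u': "u = p @ u'"
    using longest_common_prefix_prefix1 unfolding p_def prefix_def by blast
  obtain v' where v': "v = p @ v'"
    using longest_common_prefix_prefix2 unfolding p_def prefix_def by blast
  have X: "p \<in> words X" "u' \<in> words X" "v' \<in> words X"
    using u(2) v(2) unfolding u' v' by auto
  have "reduced u'" "reduced v'"
    using u(1) v(1) unfolding u' v' by (auto simp: reduced_def successively_append_iff)
  have "u' = [] \<or> v' = [] \<or> hd u' \<noteq> hd v'"
  proof (rule ccontr)
    assume "\<not> ?thesis"
    then obtain q where "prefix (p @ [q]) u" "prefix (p @ [q]) v"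
      unfolding u' v' by (cases u'; cases v') auto
    then have "prefix (p @ [q]) p"
      unfolding p_def by (rule longest_common_prefix_max_prefix)
    then show False
      by (auto simp: prefix_def)
  qed
  moreover have "inv_word u' \<noteq> [] \<longleftrightarrow> u' \<noteq> []"
    by (simp add: inv_word_def)
  moreover have "last (inv_word u') = (fst (hd u'), \<not> snd (hd u'))" if "u' \<noteq> []"
    using that by (cases u') auto
  ultimately have "reduced (inv_word u' @ v')"
    using \<open>reduced u'\<close> \<open>reduced v'\<close> reduced_inv_word[of u']
    unfolding reduced_def successively_append_iff by (auto simp: prod_eq_iff)
  moreover have "(inv_word u @ v, inv_word u' @ v') \<in> presentation_rel X {}"
  proof -
    have "(inv_word u' @ ((inv_word p @ p) @ v'), inv_word u' @ ([] @ v')) \<in> presentation_rel X {}"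
      using X inv_word_cancel[of p X "{}"]
      by (intro presentation_rel_prepend presentation_rel_append) auto
    then show ?thesis
      unfolding u' v' by simp
  qed
  ultimately have "reduce (inv_word u @ v) = inv_word u' @ v'"
    using reduce_respects reduce_id by metis
  then show ?thesis
    unfolding u' v' by simp
qed

text \<open>The reduced word of an element of a free group; by \<open>reduce_respects\<close> the chosen representative does
  not matter.\<close>

definition normal_form :: "'x word set \<Rightarrow> 'x word"
  where "normal_form A = reduce (SOME w. w \<in> A)"

lemma normal_form_class:
  assumes "w \<in> words X"
  shows "normal_form (word_class X {} w) = reduce w"
proof -
  have "w \<in> word_class X {} w"
    using assms presentation_rel.refl by auto
  then have "(w, SOME u. u \<in> word_class X {} w) \<in> presentation_rel X {}"
    by (metis Image_singleton_iff someI_ex)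
  then show ?thesis
    using reduce_respects unfolding normal_form_def by metis
qed

lemma class_normal_form:
  assumes "A \<in> carrier (free_group X)"
  shows "normal_form A \<in> words X" "word_class X {} (normal_form A) = A" "reduced (normal_form A)"
proof -
  obtain w where w: "w \<in> words X" "A = word_class X {} w"
    using assms by (auto simp: free_group_def carrier_presented_group)
  show "normal_form A \<in> words X" "word_class X {} (normal_form A) = A" "reduced (normal_form A)"
    using w word_class_eq_iff[OF w(1) reduce_in_words[OF w(1)]] reduce_rel[OF w(1)]
    by (simp_all add: normal_form_class reduce_in_words reduce_id)
qed

lemma words_mono: "X \<subseteq> Y \<Longrightarrow> words X \<subseteq> words Y"
  unfolding words_def by (intro lists_mono) auto

text \<open>A free group contains no \<open>\<int>\<^sup>2\<close>. The length of the reduced word is tree-like because the longer of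
  the prefixes that \<open>v\<close> shares with \<open>u\<close> and with \<open>w\<close> extends the shorter one, which is therefore
  common to \<open>u\<close> and \<open>w\<close>.\<close>

lemma free_group_commuting_dependent:
  assumes a: "a \<in> carrier (free_group X)" and b: "b \<in> carrier (free_group X)"
    and comm: "a \<otimes>\<^bsub>free_group X\<^esub> b = b \<otimes>\<^bsub>free_group X\<^esub> a"
  shows "\<exists>(i::int) (j::int). (i, j) \<noteq> (0, 0) \<and>
    a [^]\<^bsub>free_group X\<^esub> i \<otimes>\<^bsub>free_group X\<^esub> b [^]\<^bsub>free_group X\<^esub> j = \<one>\<^bsub>free_group X\<^esub>"
proof -
  interpret F: group "free_group X"
    unfolding free_group_def by (rule group_presented_group)
  have inv_mult: "inv\<^bsub>free_group X\<^esub> A \<otimes>\<^bsub>free_group X\<^esub> B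
      = word_class X {} (inv_word (normal_form A) @ normal_form B)"
    if "A \<in> carrier (free_group X)" "B \<in> carrier (free_group X)" for A B
    using class_normal_form[OF that(1)] class_normal_form[OF that(2)]
    unfolding free_group_def by (metis inv_presented_group inv_word_in_words mult_presented_group)
  have gp: "int (length (normal_form A)) + int (length (normal_form B))
      - int (length (normal_form (inv\<^bsub>free_group X\<^esub> A \<otimes>\<^bsub>free_group X\<^esub> B)))
      = 2 * int (length (longest_common_prefix (normal_form A) (normal_form B)))"
    if "A \<in> carrier (free_group X)" "B \<in> carrier (free_group X)" for A B
    using class_normal_form[OF that(1)] class_normal_form[OF that(2)]
      reduce_append_inv[of "normal_form A" X "normal_form B"]
    by (simp add: inv_mult that normal_form_class)
  have lcp_ultrametric: "min (length (longest_common_prefix u v)) (length (longest_common_prefix v w))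
      \<le> length (longest_common_prefix u w)" for u v w :: "'a word"
  proof -
    let ?p = "longest_common_prefix u v" and ?q = "longest_common_prefix v w"
    consider "prefix ?p ?q" | "prefix ?q ?p"
      using prefix_same_cases longest_common_prefix_prefix1 longest_common_prefix_prefix2 by blast
    then show ?thesis
    proof cases
      case 1
      then have "prefix ?p (longest_common_prefix u w)"
        by (meson longest_common_prefix_max_prefix longest_common_prefix_prefix1
            longest_common_prefix_prefix2 prefix_order.trans)
      then show ?thesis
        using prefix_length_le by fastforce
    next
      case 2
      then have "prefix ?q (longest_common_prefix u w)"
        by (meson longest_common_prefix_max_prefix longest_common_prefix_prefix1
            longest_common_prefix_prefix2 prefix_order.trans)
      then show ?thesis
        using prefix_length_le by fastforce
    qed
  qed
  define Y where "Y = fst ` set (normal_form a) \<union> fst ` set (normal_form b)"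
  have Y: "finite Y" "Y \<subseteq> X"
    using class_normal_form(1)[OF a] class_normal_form(1)[OF b]
    by (auto simp: Y_def words_def)
  have nf_Y: "normal_form a \<in> words Y" "normal_form b \<in> words Y"
    by (force simp: Y_def words_def lists_eq_set)+
  \<comment> \<open>All elements of the subgroup generated by \<open>a\<close> and \<open>b\<close> are spelled with the finitely many letters of \<open>a\<close> and \<open>b\<close>.\<close>
  define S where "S = word_class X {} ` words Y"
  have S_mult: "A \<otimes>\<^bsub>free_group X\<^esub> B \<in> S" if "A \<in> S" "B \<in> S" for A B
    using that words_mono[OF Y(2)] unfolding S_def free_group_def
    by (auto simp: mult_presented_group subset_iff)
  have S_inv: "inv\<^bsub>free_group X\<^esub> A \<in> S" if "A \<in> S" for A
    using that words_mono[OF Y(2)] unfolding S_def free_group_def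
    by (auto simp: inv_presented_group subset_iff)
  have S_one: "\<one>\<^bsub>free_group X\<^esub> \<in> S"
    unfolding S_def free_group_def by (auto simp: one_presented_group)
  have S_nat_pow: "A [^]\<^bsub>free_group X\<^esub> (n::nat) \<in> S" if "A \<in> S" for A n
    using that by (induction n) (auto intro: S_mult S_one)
  have S_pow: "A [^]\<^bsub>free_group X\<^esub> (n::int) \<in> S" if "A \<in> S" for A n
    using that by (auto simp: int_pow_def2 simp del: pow_nat intro: S_nat_pow S_inv)
  have ab: "a \<in> S" "b \<in> S"
    unfolding S_def using class_normal_form[OF a] class_normal_form[OF b] nf_Y by blast+
  have finite_ball: "finite {A \<in> S. length (normal_form A) \<le> n}" for n
  proof -
    have "{A \<in> S. length (normal_form A) \<le> n}
        \<subseteq> word_class X {} ` {w. set w \<subseteq> Y \<times> UNIV \<and> length w \<le> n}"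
    proof safe
      fix A assume A: "A \<in> S" "length (normal_form A) \<le> n"
      then obtain w where w: "w \<in> words Y" "A = word_class X {} w"
        unfolding S_def by blast
      have "normal_form A = reduce w"
        using w words_mono[OF Y(2)] normal_form_class by blast
      then have "normal_form A \<in> words Y"
        using w reduce_in_words by auto
      moreover have "A \<in> carrier (free_group X)"
        using w words_mono[OF Y(2)] by (auto simp: free_group_def carrier_presented_group)
      ultimately show "A \<in> word_class X {} ` {w. set w \<subseteq> Y \<times> UNIV \<and> length w \<le> n}"
        using A(2) class_normal_form(2)
        by (intro image_eqI[of _ _ "normal_form A"]) (auto simp: words_def)
    qed
    moreover have "finite {w. set w \<subseteq> Y \<times> (UNIV :: bool set) \<and> length w \<le> n}"
      using Y(1) by (intro finite_lists_length_le) auto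
    ultimately show ?thesis
      using finite_subset by blast
  qed
  show ?thesis
  proof (rule F.commuting_dependent_of_tree_length[where len = "\<lambda>A. length (normal_form A)"])
    fix A assume A: "A \<in> carrier (free_group X)"
    have "inv\<^bsub>free_group X\<^esub> A = word_class X {} (inv_word (normal_form A))"
      using class_normal_form[OF A] unfolding free_group_def by (metis inv_presented_group)
    then show "length (normal_form (inv\<^bsub>free_group X\<^esub> A)) = length (normal_form A)"
      using class_normal_form[OF A] reduced_inv_word reduce_id by (metis inv_word_in_words
          inv_word_simps(5) normal_form_class)
  next
    fix n
    have "{A. (\<exists>(i::int) (j::int). A = a [^]\<^bsub>free_group X\<^esub> i \<otimes>\<^bsub>free_group X\<^esub> b [^]\<^bsub>free_group X\<^esub> j)
        \<and> length (normal_form A) \<le> n} \<subseteq> {A \<in> S. length (normal_form A) \<le> n}"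
      using S_mult S_pow ab by auto
    then show "finite {A. (\<exists>(i::int) (j::int). A = a [^]\<^bsub>free_group X\<^esub> i \<otimes>\<^bsub>free_group X\<^esub> b [^]\<^bsub>free_group X\<^esub> j)
        \<and> length (normal_form A) \<le> n}"
      using finite_ball finite_subset by blast
  next
    fix A B C
    assume "A \<in> carrier (free_group X)" "B \<in> carrier (free_group X)" "C \<in> carrier (free_group X)"
    then show "min (int (length (normal_form A)) + int (length (normal_form B))
          - int (length (normal_form (inv\<^bsub>free_group X\<^esub> A \<otimes>\<^bsub>free_group X\<^esub> B))))
        (int (length (normal_form B)) + int (length (normal_form C))
          - int (length (normal_form (inv\<^bsub>free_group X\<^esub> B \<otimes>\<^bsub>free_group X\<^esub> C))))
      \<le> int (length (normal_form A)) + int (length (normal_form C))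
          - int (length (normal_form (inv\<^bsub>free_group X\<^esub> A \<otimes>\<^bsub>free_group X\<^esub> C)))"
      using lcp_ultrametric[of "normal_form A" "normal_form B" "normal_form C"]
      by (simp add: gp)
  qed (use a b comm in auto)
qed

lemma free_commuting_dependent:
  assumes "group F" and "F \<cong> free_group X"
    and a: "a \<in> carrier F" and b: "b \<in> carrier F" and comm: "a \<otimes>\<^bsub>F\<^esub> b = b \<otimes>\<^bsub>F\<^esub> a"
  shows "\<exists>(i::int) (j::int). (i, j) \<noteq> (0, 0) \<and> a [^]\<^bsub>F\<^esub> i \<otimes>\<^bsub>F\<^esub> b [^]\<^bsub>F\<^esub> j = \<one>\<^bsub>F\<^esub>"
proof -
  obtain h where h: "h \<in> iso F (free_group X)"
    using assms(2) by (auto simp: is_iso_def)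
  interpret F: group F by fact
  interpret h: group_hom F "free_group X" h
    using h group_presented_group unfolding free_group_def
    by (auto simp: group_hom_def group_hom_axioms_def iso_def \<open>group F\<close>)
  have "h a \<otimes>\<^bsub>free_group X\<^esub> h b = h b \<otimes>\<^bsub>free_group X\<^esub> h a"
    using a b comm by (metis h.hom_mult)
  then obtain i j :: int where ij: "(i, j) \<noteq> (0, 0)"
    "h a [^]\<^bsub>free_group X\<^esub> i \<otimes>\<^bsub>free_group X\<^esub> h b [^]\<^bsub>free_group X\<^esub> j = \<one>\<^bsub>free_group X\<^esub>"
    using free_group_commuting_dependent[of "h a" X "h b"] a b by auto
  have "h (a [^]\<^bsub>F\<^esub> i \<otimes>\<^bsub>F\<^esub> b [^]\<^bsub>F\<^esub> j) = h \<one>\<^bsub>F\<^esub>"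
    using ij a b by (simp add: h.hom_int_pow)
  moreover have "inj_on h (carrier F)"
    using h by (auto simp: iso_def bij_betw_def)
  ultimately have "a [^]\<^bsub>F\<^esub> i \<otimes>\<^bsub>F\<^esub> b [^]\<^bsub>F\<^esub> j = \<one>\<^bsub>F\<^esub>"
    using a b by (meson F.int_pow_closed F.m_closed F.one_closed inj_onD)
  with ij show ?thesis
    by blast
qed

section \<open>Finitely generated free groups\<close>

text \<open>A generator that occurs in none of the finitely many reduced words would be detected by the
  homomorphism to \<open>\<int>\<close> that counts its occurrences, although this homomorphism kills the whole
  generating set.\<close>

lemma free_group_finitely_generated_imp_finite:
  assumes "finite S" and S: "S \<subseteq> carrier (free_group X)"
    and gen: "generate (free_group X) S = carrier (free_group X)"
  shows "finite X"
proof -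
  interpret F: group "free_group X"
    unfolding free_group_def by (rule group_presented_group)
  define Y where "Y = (\<Union>A\<in>S. fst ` set (normal_form A))"
  have "finite Y"
    using \<open>finite S\<close> by (simp add: Y_def)
  have "X \<subseteq> Y"
  proof
    fix x assume x: "x \<in> X"
    show "x \<in> Y"
    proof (rule ccontr)
      assume "x \<notin> Y"
      define \<phi> :: "'a \<Rightarrow> int" where "\<phi> y = (if y = x then 1 else 0)" for y
      interpret Z: group integer_group by simp
      obtain h where h: "h \<in> hom (free_group X) integer_group"
        and h_class: "\<And>w. w \<in> words X \<Longrightarrow> h (word_class X {} w) = word_eval integer_group \<phi> w"
        unfolding free_group_def by (rule Z.presented_group_lift[of \<phi> X "{}"]) auto
      have eval_0: "word_eval integer_group \<phi> w = 0" if "x \<notin> fst ` set w" for w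
        using that by (induction w) (auto simp: \<phi>_def)
      interpret h: group_hom "free_group X" integer_group h
        using h by (simp add: group_hom_def group_hom_axioms_def)
      have "h A = 0" if "A \<in> S" for A
        using that S \<open>x \<notin> Y\<close> class_normal_form[of A X] h_class[of "normal_form A"] eval_0[of "normal_form A"]
        by (auto simp: Y_def)
      then have "S \<subseteq> kernel (free_group X) integer_group h"
        using S by (auto simp: kernel_def)
      then have "carrier (free_group X) \<subseteq> kernel (free_group X) integer_group h"
        using F.generate_subgroup_incl h.subgroup_kernel gen by blast
      moreover have "word_class X {} [(x, True)] \<in> carrier (free_group X)"
        using x by (simp add: free_group_def carrier_presented_group)
      ultimately have "h (word_class X {} [(x, True)]) = 0"
        by (auto simp: kernel_def)
      then show False
        using h_class[of "[(x, True)]"] x by (simp add: \<phi>_def)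
    qed
  qed
  then show ?thesis
    using \<open>finite Y\<close> finite_subset by blast
qed

lemma presentation_rel_map:
  assumes "(u, w) \<in> presentation_rel X {}"
  shows "(map (map_prod f id) u, map (map_prod f id) w) \<in> presentation_rel (f ` X) {}"
proof -
  have map_words: "map (map_prod f id) w \<in> words (f ` X)" if "w \<in> words X" for w
    using that by (fastforce simp: words_def)
  from assms show ?thesis
  proof induction
    case (cancel u w x b)
    then show ?case
      using presentation_rel.cancel[OF map_words map_words, of u w "f x" b "{}"] by (simp add: id_def)
  qed (blast intro: presentation_rel.intros map_words)+
qed

lemma free_group_cong_bij:
  assumes "bij_betw f X Y"
  shows "free_group X \<cong> free_group Y"
proof -
  define g where "g = inv_into X f"
  have gf: "g (f x) = x" if "x \<in> X" for x
    using assms that by (simp add: g_def bij_betw_inv_into_left)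
  have Y: "Y = f ` X"
    using assms by (simp add: bij_betw_def)
  define \<phi> where "\<phi> x = word_class Y {} [(f x, True)]" for x
  interpret FY: group "free_group Y"
    unfolding free_group_def by (rule group_presented_group)
  have \<phi>: "\<phi> \<in> X \<rightarrow> carrier (free_group Y)"
    by (auto simp: \<phi>_def free_group_def carrier_presented_group Y)
  obtain h where h: "h \<in> hom (free_group X) (free_group Y)"
    and h_class: "\<And>w. w \<in> words X \<Longrightarrow> h (word_class X {} w) = word_eval (free_group Y) \<phi> w"
    using FY.presented_group_lift[OF \<phi>, of "{}"] unfolding free_group_def by auto
  have eval: "word_eval (free_group Y) \<phi> w = word_class Y {} (map (map_prod f id) w)
      \<and> map (map_prod f id) w \<in> words Y" if "w \<in> words X" for w
    using that
  proof (induction w)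
    case (Cons p w)
    obtain x b where p: "p = (x, b)"
      by fastforce
    have x: "x \<in> X" "w \<in> words X"
      using Cons.prems p by auto
    have "(if b then \<phi> x else inv\<^bsub>free_group Y\<^esub> \<phi> x) = word_class Y {} [(f x, b)]"
      using x by (auto simp: \<phi>_def free_group_def inv_presented_group Y)
    then show ?case
      using Cons.IH[OF x(2)] x p by (auto simp: free_group_def mult_presented_group Y)
  qed (simp add: free_group_def one_presented_group)
  have map_gf: "map (map_prod g id) (map (map_prod f id) w) = w" if "w \<in> words X" for w
    using that by (induction w) (auto simp: gf)
  have "inj_on h (carrier (free_group X))"
  proof (rule inj_onI)
    fix A B
    assume "A \<in> carrier (free_group X)" "B \<in> carrier (free_group X)" and eq: "h A = h B"
    then obtain u w where uw: "u \<in> words X" "w \<in> words X" "A = word_class X {} u" "B = word_class X {} w"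
      by (auto simp: free_group_def carrier_presented_group)
    then have "(map (map_prod f id) u, map (map_prod f id) w) \<in> presentation_rel Y {}"
      using eq h_class eval word_class_eq_iff by metis
    then have "(u, w) \<in> presentation_rel (g ` Y) {}"
      using presentation_rel_map[of _ _ Y g] uw map_gf by metis
    moreover have "g ` Y = X"
      using gf by (force simp: Y)
    ultimately show "A = B"
      using uw by (simp add: word_class_eq_iff)
  qed
  moreover have "h ` carrier (free_group X) = carrier (free_group Y)"
  proof -
    have "words Y = map (map_prod f id) ` words X"
    proof -
      have "(f ` X) \<times> UNIV = map_prod f id ` (X \<times> (UNIV :: bool set))"
        by force
      then show ?thesis
        unfolding words_def Y by (metis lists_image)
    qed
    then show ?thesis
      using h_class eval by (force simp: free_group_def carrier_presented_group image_image)
  qed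
  ultimately show ?thesis
    using h by (auto simp: is_iso_def iso_def bij_betw_def)
qed

lemma free_finitely_generated_imp_finite_rank:
  assumes "group F" and F: "F \<cong> free_group X"
    and S: "finite S" "S \<subseteq> carrier F" "generate F S = carrier F"
  shows "\<exists>n. is_free_of_rank n F"
proof -
  obtain h where h: "h \<in> iso F (free_group X)"
    using F by (auto simp: is_iso_def)
  interpret h: group_hom F "free_group X" h
    using h group_presented_group unfolding free_group_def
    by (auto simp: group_hom_def group_hom_axioms_def iso_def \<open>group F\<close>)
  have "h ` carrier F = carrier (free_group X)"
    using h by (auto simp: iso_def bij_betw_def)
  then have "finite X"
    using S h.generate_img[of S]
    by (intro free_group_finitely_generated_imp_finite[of "h ` S"]) auto
  then obtain f where "bij_betw f X {..<card X}"
    by (metis atLeast0LessThan ex_bij_betw_finite_nat)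
  then show ?thesis
    using F free_group_cong_bij iso_trans unfolding is_free_of_rank_def by blast
qed

section \<open>Finite generation from cocompact actions\<close>

text \<open>A group is finitely generated if it acts on a connected graph with finitely many orbits of edges and
  finitely generated stabilizers. Here \<open>R\<close> contains the base point and the ends of a representative
  of each orbit of edges; besides the stabilizers of its points, the generators are one element
  \<open>transporter r r'\<close> for each pair of points of \<open>R\<close> in the same orbit. The subgroup that they generate
  then contains every element that carries a point of \<open>R\<close> into \<open>R\<close>; following a path from the base
  point \<open>y\<^sub>0\<close> edge by edge, the translates of \<open>R\<close> under this subgroup are seen to cover the orbit of
  \<open>y\<^sub>0\<close>.

  As \<open>E\<close> is a set of ordered pairs, it has to contain both orientations of an edge that is to be
  crossed in both directions.\<close>

lemma (in group) finitely_generated_of_cocompact_action: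
  fixes act :: "'a \<Rightarrow> 'y \<Rightarrow> 'y"
  assumes K: "subgroup K G"
    and act_mult: "\<And>g h r. g \<in> K \<Longrightarrow> h \<in> K \<Longrightarrow> r \<in> R \<Longrightarrow> act (g \<otimes> h) r = act g (act h r)"
    and act_one: "\<And>r. r \<in> R \<Longrightarrow> act \<one> r = r"
    and R: "finite R" "y\<^sub>0 \<in> R"
    and edges: "\<And>y y'. (y, y') \<in> E \<Longrightarrow> \<exists>k\<in>K. \<exists>r\<in>R. \<exists>r'\<in>R. y = act k r \<and> y' = act k r'"
    and connected: "\<And>k. k \<in> K \<Longrightarrow> (y\<^sub>0, act k y\<^sub>0) \<in> E\<^sup>*"
    and stabilizers: "\<And>r. r \<in> R \<Longrightarrow>
      \<exists>S. finite S \<and> S \<subseteq> K \<and> generate G S = {k \<in> K. act k r = r}"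
  shows "\<exists>S. finite S \<and> S \<subseteq> K \<and> generate G S = K"
proof -
  interpret K: subgroup K G by fact
  obtain gens where gens: "\<And>r. r \<in> R \<Longrightarrow> finite (gens r) \<and> gens r \<subseteq> K"
    "\<And>r. r \<in> R \<Longrightarrow> generate G (gens r) = {k \<in> K. act k r = r}"
    using stabilizers by metis
  define transporter where "transporter r r' = (SOME k. k \<in> K \<and> act k r = r')" for r r'
  have transporter: "transporter r r' \<in> K \<and> act (transporter r r') r = r'" if "k \<in> K" "act k r = r'" for k r r'
    unfolding transporter_def using that by (rule_tac someI[of _ k]) simp
  define S where "S = (\<Union>r\<in>R. gens r) \<union> (\<lambda>(r, r'). transporter r r') ` {(r, r') \<in> R \<times> R. \<exists>k\<in>K. act k r = r'}"
  have "finite S"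
    unfolding S_def using R(1) gens(1)
    by (intro finite_UnI finite_UN_I finite_imageI) (auto intro: finite_subset[of _ "R \<times> R"])
  have "S \<subseteq> K"
    unfolding S_def using gens(1) transporter by fastforce
  then interpret L: subgroup "generate G S" G
    by (meson K.subset generate_is_subgroup subset_trans)
  have L_K: "generate G S \<subseteq> K"
    using \<open>S \<subseteq> K\<close> K generate_subgroup_incl by blast
  have act_cancel: "act (inv l \<otimes> k) r = r'"
    if "l \<in> K" "k \<in> K" "r \<in> R" "r' \<in> R" "act k r = act l r'" for k l r r'
  proof -
    have "act (inv l \<otimes> k) r = act (inv l) (act l r')"
      using act_mult[of "inv l" k r] that by simp
    also have "\<dots> = act (inv l \<otimes> l) r'"
      using act_mult[of "inv l" l r'] that K.m_inv_closed by metis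
    finally show ?thesis
      using that act_one by simp
  qed
  have transport: "k \<in> generate G S" if "k \<in> K" "r \<in> R" "r' \<in> R" "act k r = r'" for k r r'
  proof -
    let ?t = "transporter r r'"
    have t: "?t \<in> K" "act ?t r = r'"
      using transporter[OF that(1,4)] by auto
    have "?t \<in> generate G S"
      using that by (intro generate.incl) (auto simp: S_def)
    have "act (inv ?t \<otimes> k) r = r"
      using act_cancel t that by metis
    then have "inv ?t \<otimes> k \<in> generate G (gens r)"
      using gens(2)[OF that(2)] that(1) t(1) by simp
    then have "inv ?t \<otimes> k \<in> generate G S"
      using mono_generate[of "gens r" S] that(2) by (auto simp: S_def)
    then have "?t \<otimes> (inv ?t \<otimes> k) \<in> generate G S"
      using \<open>?t \<in> generate G S\<close> by blast
    then show ?thesis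
      using that(1) t(1) by (simp add: m_assoc[symmetric])
  qed
  have reach: "\<exists>l\<in>generate G S. \<exists>r\<in>R. y = act l r" if "(y\<^sub>0, y) \<in> E\<^sup>*" for y
    using that
  proof induction
    case base
    then show ?case
      using act_one R(2) L.one_closed by metis
  next
    case (step y y')
    then obtain l r where l: "l \<in> generate G S" "r \<in> R" "y = act l r"
      by blast
    obtain k q q' where k: "k \<in> K" "q \<in> R" "q' \<in> R" "y = act k q" "y' = act k q'"
      using edges step.hyps by blast
    have lK: "l \<in> K"
      using l L_K by blast
    have "act (inv l \<otimes> k) q = r"
      using act_cancel k l lK by metis
    then have "inv l \<otimes> k \<in> generate G S"
      using transport[of "inv l \<otimes> k" q r] k l lK by simp
    then have "l \<otimes> (inv l \<otimes> k) \<in> generate G S"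
      using l by blast
    then have "k \<in> generate G S"
      using lK k(1) by (simp add: m_assoc[symmetric])
    then show ?case
      using k by blast
  qed
  have "k \<in> generate G S" if k: "k \<in> K" for k
  proof -
    obtain l r where l: "l \<in> generate G S" "r \<in> R" "act k y\<^sub>0 = act l r"
      using reach[OF connected[OF k]] by blast
    have lK: "l \<in> K"
      using l L_K by blast
    have "act (inv l \<otimes> k) y\<^sub>0 = r"
      using act_cancel k l lK R(2) by metis
    then have "inv l \<otimes> k \<in> generate G S"
      using transport[of "inv l \<otimes> k" "y\<^sub>0" r] k l lK R(2) by simp
    then have "l \<otimes> (inv l \<otimes> k) \<in> generate G S"
      using l by blast
    then show ?thesis
      using lK k by (simp add: m_assoc[symmetric])
  qed
  then show ?thesis
    using \<open>finite S\<close> \<open>S \<subseteq> K\<close> L_K by blast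
qed

section \<open>Subgroups of \<open>\<int>\<^sup>2\<close>\<close>

text \<open>The map \<open>f\<close> is multiplication of \<open>c\<close> by integers; it is a variable so that the lemma covers both
  \<open>\<int>\<close> and \<open>\<int>\<^sup>2\<close>.\<close>

lemma int_mult_closed:
  fixes C :: "'b::ab_group_add set"
  assumes "0 \<in> C" and "\<And>x y. x \<in> C \<Longrightarrow> y \<in> C \<Longrightarrow> x - y \<in> C"
    and "c \<in> C" and f: "f 0 = 0" "\<And>n. f (n + 1) = f n + c"
  shows "f (n::int) \<in> C"
proof -
  have plus: "x + y \<in> C" if "x \<in> C" "y \<in> C" for x y
    using assms(2)[OF that(1) assms(2)[OF assms(1) that(2)]] by simp
  have "f (int k) \<in> C" for k
    using assms(1,3) plus f by (induction k) (auto simp: add.commute[of 1])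
  moreover have "f (- int k) \<in> C" for k
  proof (induction k)
    case (Suc k)
    have "f (- int k) = f (- int (Suc k)) + c"
      using f(2)[of "- int (Suc k)"] by (simp add: algebra_simps)
    then have "f (- int (Suc k)) = f (- int k) - c"
      by simp
    then show ?case
      using Suc assms(2,3) by metis
  qed (use assms(1) f in simp)
  ultimately show ?thesis
    by (metis int_cases2)
qed

lemma int_subgroup_cyclic:
  fixes C :: "int set"
  assumes zero: "0 \<in> C" and diff: "\<And>x y. x \<in> C \<Longrightarrow> y \<in> C \<Longrightarrow> x - y \<in> C"
  obtains d where "d \<in> C" "\<And>c. c \<in> C \<Longrightarrow> d dvd c"
proof (cases "C \<subseteq> {0}")
  case True
  then show ?thesis
    using that zero by force
next
  case False
  have mult: "n * c \<in> C" if "c \<in> C" for n c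
    by (rule int_mult_closed[of C c "\<lambda>n. n * c"]) (use zero diff that in \<open>auto simp: algebra_simps\<close>)
  define d where "d = int (LEAST n. n > 0 \<and> int n \<in> C)"
  obtain c where "c \<in> C" "c \<noteq> 0"
    using False by blast
  then have "\<bar>c\<bar> \<in> C"
    using mult[of c "-1"] by (auto simp: abs_if)
  then have "nat \<bar>c\<bar> > 0 \<and> int (nat \<bar>c\<bar>) \<in> C"
    using \<open>c \<noteq> 0\<close> by simp
  then have "(LEAST n. n > 0 \<and> int n \<in> C) > 0 \<and> int (LEAST n. n > 0 \<and> int n \<in> C) \<in> C"
    by (rule LeastI)
  then have d: "d > 0" "d \<in> C"
    unfolding d_def by auto
  have "d dvd x" if "x \<in> C" for x
  proof (rule ccontr)
    assume "\<not> d dvd x"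
    then have pos: "0 < x mod d"
      using d(1) by (metis dvd_eq_mod_eq_0 pos_mod_sign order_le_less)
    have "x mod d = x - (x div d) * d"
      by (simp add: minus_div_mult_eq_mod)
    then have "x mod d \<in> C"
      using diff[OF that mult[OF d(2)]] by simp
    then have "(LEAST n. n > 0 \<and> int n \<in> C) \<le> nat (x mod d)"
      using pos by (intro Least_le) auto
    moreover have "x mod d < d"
      using d(1) by simp
    ultimately show False
      using pos by (simp add: d_def)
  qed
  then show ?thesis
    using that d by blast
qed

abbreviation int_scale :: "int \<Rightarrow> int \<times> int \<Rightarrow> int \<times> int"
  where "int_scale n z \<equiv> (n * fst z, n * snd z)"

lemma int_pair_subgroup_two_generated:
  fixes B :: "(int \<times> int) set"
  assumes zero: "0 \<in> B" and diff: "\<And>x y. x \<in> B \<Longrightarrow> y \<in> B \<Longrightarrow> x - y \<in> B"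
  obtains b c where "b \<in> B" "c \<in> B" "\<And>z. z \<in> B \<Longrightarrow> \<exists>m n. z = int_scale m b + int_scale n c"
proof -
  have mult: "int_scale n b \<in> B" if "b \<in> B" for n b
    by (rule int_mult_closed[of B b "\<lambda>n. int_scale n b"])
      (use zero diff that in \<open>auto simp: algebra_simps zero_prod_def prod_eq_iff\<close>)
  obtain d where d: "d \<in> snd ` B" "\<And>c. c \<in> snd ` B \<Longrightarrow> d dvd c"
  proof (rule int_subgroup_cyclic[of "snd ` B"])
    show "0 \<in> snd ` B"
      using zero by force
    show "x - y \<in> snd ` B" if "x \<in> snd ` B" "y \<in> snd ` B" for x y
      using that diff by (metis (no_types, lifting) image_iff snd_diff)
  qed blast
  obtain e where e: "(e, 0) \<in> B" "\<And>x. (x, 0) \<in> B \<Longrightarrow> e dvd x"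
  proof (rule int_subgroup_cyclic[of "{x. (x, 0) \<in> B}"])
    show "x - y \<in> {x. (x, 0) \<in> B}" if "x \<in> {x. (x, 0) \<in> B}" "y \<in> {x. (x, 0) \<in> B}" for x y
      using diff[of "(x, 0)" "(y, 0)"] that by simp
  qed (use zero in \<open>auto simp: zero_prod_def\<close>)
  obtain c where c: "c \<in> B" "snd c = d"
    using d(1) by blast
  have "\<exists>m n. z = int_scale m (e, 0) + int_scale n c" if z: "z \<in> B" for z
  proof -
    obtain n where n: "snd z = d * n"
      using d(2) z by (meson dvdE imageI)
    have "z - int_scale n c = (fst z - n * fst c, 0)"
      using n c(2) by (simp add: prod_eq_iff)
    then have "(fst z - n * fst c, 0) \<in> B"
      using diff[OF z mult[OF c(1), of n]] by simp
    then obtain m where "fst z - n * fst c = e * m"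
      using e(2) by (meson dvdE)
    then show ?thesis
      using n c(2) by (intro exI[of _ m] exI[of _ n]) (simp add: prod_eq_iff algebra_simps)
  qed
  then show ?thesis
    using that e(1) c(1) by blast
qed

section \<open>Additive bijections of the plane\<close>

definition bijections :: "('b \<Rightarrow> 'b) monoid"
  where "bijections = \<lparr>carrier = {f. bij f}, monoid.mult = (\<circ>), one = id\<rparr>"

lemma bijections_simps [simp]:
  "f \<in> carrier bijections \<longleftrightarrow> bij f" "f \<otimes>\<^bsub>bijections\<^esub> g = f \<circ> g" "\<one>\<^bsub>bijections\<^esub> = id"
  by (simp_all add: bijections_def)

lemma group_bijections: "group bijections"
proof (rule groupI)
  fix f :: "'b \<Rightarrow> 'b" assume "f \<in> carrier bijections"
  then show "\<exists>g\<in>carrier bijections. g \<otimes>\<^bsub>bijections\<^esub> f = \<one>\<^bsub>bijections\<^esub>"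
    by (intro bexI[of _ "inv_into UNIV f"]) (auto simp: bij_imp_bij_inv bij_is_inj)
qed (auto simp: bij_comp comp_assoc)

text \<open>The determinant of two vectors of \<open>\<int>\<^sup>2\<close>.\<close>

definition cross :: "int \<times> int \<Rightarrow> int \<times> int \<Rightarrow> int"
  where "cross p q = fst p * snd q - snd p * fst q"

definition cplx :: "int \<times> int \<Rightarrow> complex"
  where "cplx z = Complex (fst z) (snd z)"

lemma cplx_simps [simp]:
  "cplx (y + z) = cplx y + cplx z" "cplx (- z) = - cplx z" "cplx 0 = 0" "cplx z = 0 \<longleftrightarrow> z = 0"
  "cplx y = cplx z \<longleftrightarrow> y = z"
  by (auto simp: cplx_def complex_eq_iff prod_eq_iff)

text \<open>The real-linear map of the plane with \<open>1 \<mapsto> p\<close> and \<open>\<i> \<mapsto> q\<close>.\<close>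

definition frame :: "int \<times> int \<Rightarrow> int \<times> int \<Rightarrow> complex \<Rightarrow> complex"
  where "frame p q z = of_real (Re z) * cplx p + of_real (Im z) * cplx q"

lemma frame_simps:
  "frame p q (y + z) = frame p q y + frame p q z"
  "frame p q 1 = cplx p" "frame p q \<i> = cplx q"
  by (simp_all add: frame_def algebra_simps)

lemma bij_frame:
  assumes "cross p q \<noteq> 0"
  shows "bij (frame p q)"
proof -
  define d :: real where "d = fst p * snd q - snd p * fst q"
  have "d = of_int (cross p q)"
    by (simp add: d_def cross_def)
  then have "d \<noteq> 0"
    using assms by simp
  \<comment> \<open>Cramer's rule\<close>
  define g where "g z = Complex ((Re z * snd q - Im z * fst q) / d) ((fst p * Im z - snd p * Re z) / d)" for z
  have "g (frame p q z) = z" for z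
    using \<open>d \<noteq> 0\<close> by (simp add: g_def frame_def complex_eq_iff cplx_def field_simps) (simp add: d_def algebra_simps)
  moreover have "frame p q (g z) = z" for z
    using \<open>d \<noteq> 0\<close> by (simp add: g_def frame_def complex_eq_iff cplx_def field_simps) (simp add: d_def algebra_simps)
  ultimately show ?thesis
    by (metis bijI')
qed

lemma exists_additive_bijection:
  assumes "cross p q \<noteq> 0" "cross p' q' \<noteq> 0"
  obtains M where "bij M" "\<And>y z. M (y + z) = M y + M z" "M (cplx p) = cplx p'" "M (cplx q) = cplx q'"
proof
  let ?F = "frame p q" and ?F' = "frame p' q'"
  have F: "bij ?F" "bij ?F'"
    using assms by (auto intro: bij_frame)
  then have inv: "inv_into UNIV ?F (?F z) = z" "?F (inv_into UNIV ?F z) = z" for z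
    by (auto simp: bij_is_inj bij_is_surj surj_f_inv_f)
  show "bij (?F' \<circ> inv_into UNIV ?F)"
    using F by (intro bij_comp bij_imp_bij_inv)
  have "inv_into UNIV ?F (y + z) = inv_into UNIV ?F y + inv_into UNIV ?F z" for y z
    by (metis inv frame_simps(1))
  then show "(?F' \<circ> inv_into UNIV ?F) (y + z) = (?F' \<circ> inv_into UNIV ?F) y + (?F' \<circ> inv_into UNIV ?F) z" for y z
    by (simp add: frame_simps)
  show "(?F' \<circ> inv_into UNIV ?F) (cplx p) = cplx p'" "(?F' \<circ> inv_into UNIV ?F) (cplx q) = cplx q'"
    using inv(1)[of 1] inv(1)[of \<i>] by (simp_all add: frame_simps)
qed

section \<open>Coordinates on a tubular graph of groups\<close>

lemma (in group) hom_integer_group_eq: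
  assumes "h \<in> hom integer_group G"
  shows "h n = h 1 [^] (n::int)"
proof -
  interpret h: group_hom integer_group G h
    using assms by (simp add: group_hom_def group_hom_axioms_def)
  show ?thesis
    using h.hom_int_pow[of 1 n] by simp
qed

lemma (in group) conj_int_pow:
  assumes "g \<in> carrier G" "x \<in> carrier G"
  shows "(g \<otimes> x \<otimes> inv g) [^] (n::int) = g \<otimes> x [^] n \<otimes> inv g"
proof -
  have "(\<lambda>x. g \<otimes> x \<otimes> inv g) \<in> hom G G"
    using assms by (intro homI) (simp_all add: m_assoc inv_solve_left)
  then show ?thesis
    using assms hom_int_pow[of "\<lambda>x. g \<otimes> x \<otimes> inv g" G G x n] is_group by simp
qed

lemma (in group) eq_of_mult_inv_eq_one:
  assumes "x \<in> carrier G" "y \<in> carrier G" "x \<otimes> inv y = \<one>"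
  shows "x = y"
  using inv_equality[OF assms(3)] assms(1,2) by simp

text \<open>A tubular graph of groups with chosen identifications of the vertex groups with \<open>\<int>\<^sup>2\<close> and of the edge
  groups with \<open>\<int>\<close>. The group \<open>P\<close> is the big group of Serre, in which there are no relations for a
  spanning tree: it contains the fundamental groups at all base points, and once the images
  of the vertex groups in a representation are fixed, the image of each stable letter is subject only
  to the relators of its own arc.\<close>

locale tubular_graph_of_groups = graph_of_groups \<G>
  for \<G> :: "('v, 'e, 'a, 'b) graph_of_groups" +
  fixes basis :: "'v \<Rightarrow> int \<times> int \<Rightarrow> 'a" and edge_iso :: "'e \<Rightarrow> int \<Rightarrow> 'b"
  assumes finite_arcs: "finite (arcs (graph \<G>))"
    and basis: "v \<in> verts (graph \<G>) \<Longrightarrow> basis v \<in> iso (integer_group \<times>\<times> integer_group) (vertex_group \<G> v)"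
    and edge_iso: "e \<in> arcs (graph \<G>) \<Longrightarrow> edge_iso e \<in> iso integer_group (edge_group \<G> e)"
begin

abbreviation V where "V \<equiv> verts (graph \<G>)"
abbreviation E where "E \<equiv> arcs (graph \<G>)"
abbreviation src where "src \<equiv> tail (graph \<G>)"
abbreviation tgt where "tgt \<equiv> head (graph \<G>)"
abbreviation gens where "gens \<equiv> gog_generators \<G>"
abbreviation rels where "rels \<equiv> gog_relators \<G>"
abbreviation cls where "cls \<equiv> word_class gens rels"

definition P :: "('v, 'e, 'a) gog_generator word set monoid"
  where "P = presented_group gens rels"

sublocale P: group P
  unfolding P_def by (rule group_presented_group)

definition vertex_elt :: "'v \<Rightarrow> int \<times> int \<Rightarrow> ('v, 'e, 'a) gog_generator word set"
  where "vertex_elt v z = cls [(Vertex_Elt v (basis v z), True)]"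

definition stable :: "'e \<Rightarrow> ('v, 'e, 'a) gog_generator word set"
  where "stable e = cls [(Stable_Letter e, True)]"

text \<open>The generator of the edge group of \<open>e\<close>, as a vector in the two adjacent vertex groups.\<close>

definition tail_vec :: "'e \<Rightarrow> int \<times> int"
  where "tail_vec e = inv_into UNIV (basis (src e)) (tail_map \<G> e (edge_iso e 1))"

definition head_vec :: "'e \<Rightarrow> int \<times> int"
  where "head_vec e = inv_into UNIV (basis (tgt e)) (head_map \<G> e (edge_iso e 1))"

lemma ends_in_V: "e \<in> E \<Longrightarrow> src e \<in> V" "e \<in> E \<Longrightarrow> tgt e \<in> V"
  using graph_wf by (simp_all add: wf_digraph_def)

lemma basis_props:
  assumes "v \<in> V"
  shows "basis v (y + z) = basis v y \<otimes>\<^bsub>vertex_group \<G> v\<^esub> basis v z"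
    and "inj (basis v)" and "range (basis v) = carrier (vertex_group \<G> v)"
    and "basis v z \<in> carrier (vertex_group \<G> v)"
proof -
  have h: "basis v \<in> hom (integer_group \<times>\<times> integer_group) (vertex_group \<G> v)"
    and b: "bij_betw (basis v) UNIV (carrier (vertex_group \<G> v))"
    using basis[OF assms] by (simp_all add: iso_def)
  show "basis v (y + z) = basis v y \<otimes>\<^bsub>vertex_group \<G> v\<^esub> basis v z"
    using hom_mult[OF h, of y z] by (cases y, cases z) (simp)
  show "inj (basis v)" "range (basis v) = carrier (vertex_group \<G> v)"
    using b by (auto simp: bij_betw_def)
  then show "basis v z \<in> carrier (vertex_group \<G> v)"
    by blast
qed

lemma vertex_gen [simp]: "v \<in> V \<Longrightarrow> Vertex_Elt v (basis v z) \<in> gens"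
  using basis_props(4) by (auto simp: gog_generators_def)

lemma stable_gen [simp]: "e \<in> E \<Longrightarrow> Stable_Letter e \<in> gens"
  by (auto simp: gog_generators_def)

lemma vertex_letter_in_words: "v \<in> V \<Longrightarrow> [(Vertex_Elt v (basis v z), b)] \<in> words gens"
  by simp

lemma stable_letter_in_words: "e \<in> E \<Longrightarrow> [(Stable_Letter e, b)] \<in> words gens"
  by simp

lemma cls_append:
  "u \<in> words gens \<Longrightarrow> w \<in> words gens \<Longrightarrow> cls (u @ w) = cls u \<otimes>\<^bsub>P\<^esub> cls w"
  by (simp add: P_def mult_presented_group)

lemma cls_closed: "u \<in> words gens \<Longrightarrow> cls u \<in> carrier P"
  by (simp add: P_def carrier_presented_group)

lemma vertex_elt_closed [simp]: "v \<in> V \<Longrightarrow> vertex_elt v z \<in> carrier P"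
  by (simp add: vertex_elt_def cls_closed vertex_letter_in_words)

lemma stable_closed [simp]: "e \<in> E \<Longrightarrow> stable e \<in> carrier P"
  by (simp add: stable_def cls_closed stable_letter_in_words)

lemma cls_inv: "u \<in> words gens \<Longrightarrow> cls (inv_word u) = inv\<^bsub>P\<^esub> cls u"
  by (simp add: P_def inv_presented_group)

lemma cls_relator:
  assumes "r \<in> rels" "r \<in> words gens"
  shows "cls r = \<one>\<^bsub>P\<^esub>"
proof -
  have "(r, []) \<in> presentation_rel gens rels"
    using presentation_rel.relator[of "[]" gens "[]" r rels] assms by simp
  then show ?thesis
    using assms by (simp add: P_def one_presented_group word_class_eq_iff)
qed

lemma vertex_elt_add:
  assumes "v \<in> V"
  shows "vertex_elt v (y + z) = vertex_elt v y \<otimes>\<^bsub>P\<^esub> vertex_elt v z"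
proof -
  let ?y = "[(Vertex_Elt v (basis v y), True)]" and ?z = "[(Vertex_Elt v (basis v z), True)]"
    and ?s = "[(Vertex_Elt v (basis v (y + z)), True)]"
  have W: "?y \<in> words gens" "?z \<in> words gens" "?s \<in> words gens"
    using assms vertex_letter_in_words by auto
  have "?y @ ?z @ inv_word ?s \<in> rels"
    using assms basis_props[OF assms] by (fastforce simp: gog_relators_def)
  then have "cls (?y @ ?z @ inv_word ?s) = \<one>\<^bsub>P\<^esub>"
    using W by (intro cls_relator) auto
  then have "vertex_elt v y \<otimes>\<^bsub>P\<^esub> (vertex_elt v z \<otimes>\<^bsub>P\<^esub> inv\<^bsub>P\<^esub> vertex_elt v (y + z)) = \<one>\<^bsub>P\<^esub>"
    unfolding vertex_elt_def using W by (simp only: cls_append cls_inv inv_word_in_words words_simps)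
  then have "(vertex_elt v y \<otimes>\<^bsub>P\<^esub> vertex_elt v z) \<otimes>\<^bsub>P\<^esub> inv\<^bsub>P\<^esub> vertex_elt v (y + z) = \<one>\<^bsub>P\<^esub>"
    using assms by (simp add: P.m_assoc)
  then show ?thesis
    using P.eq_of_mult_inv_eq_one[of "vertex_elt v y \<otimes>\<^bsub>P\<^esub> vertex_elt v z" "vertex_elt v (y + z)"] assms by simp
qed

lemma vertex_elt_0 [simp]:
  assumes "v \<in> V" shows "vertex_elt v 0 = \<one>\<^bsub>P\<^esub>"
proof -
  have "vertex_elt v 0 \<otimes>\<^bsub>P\<^esub> vertex_elt v 0 = vertex_elt v 0"
    using vertex_elt_add[OF assms, of 0 0] by simp
  then show ?thesis
    using assms by (simp add: P.l_cancel_one')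
qed

lemma vertex_elt_uminus: "v \<in> V \<Longrightarrow> vertex_elt v (- z) = inv\<^bsub>P\<^esub> vertex_elt v z"
  by (rule P.inv_equality[symmetric]) (simp_all flip: vertex_elt_add)

lemma vertex_elt_scale:
  assumes "v \<in> V" shows "vertex_elt v (int_scale n z) = vertex_elt v z [^]\<^bsub>P\<^esub> n"
proof -
  have "(\<lambda>n. vertex_elt v (int_scale n z)) \<in> hom integer_group P"
    using assms by (intro homI) (auto simp: vertex_elt_add[symmetric] distrib_right)
  from P.hom_integer_group_eq[OF this, of n] show ?thesis
    by simp
qed

lemma edge_map_scale:
  assumes "e \<in> E"
  shows "tail_map \<G> e (edge_iso e n) = basis (src e) (int_scale n (tail_vec e))"
    and "head_map \<G> e (edge_iso e n) = basis (tgt e) (int_scale n (head_vec e))"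
    and "tail_vec e \<noteq> 0" "head_vec e \<noteq> 0"
proof -
  have *: "h (edge_iso e n) = basis v (int_scale n (inv_into UNIV (basis v) (h (edge_iso e 1))))
      \<and> inv_into UNIV (basis v) (h (edge_iso e 1)) \<noteq> 0"
    if h: "h \<in> mon (edge_group \<G> e) (vertex_group \<G> v)" and v: "v \<in> V" for h v n
  proof -
    define z where "z = inv_into UNIV (basis v) (h (edge_iso e 1))"
    interpret A: group "vertex_group \<G> v"
      using v by (rule vertex_group_is_group)
    have ei: "edge_iso e \<in> hom integer_group (edge_group \<G> e)" "inj (edge_iso e)"
      using edge_iso[OF assms] by (auto simp: iso_def bij_betw_def)
    then have hom: "(\<lambda>n. h (edge_iso e n)) \<in> hom integer_group (vertex_group \<G> v)"
      using h hom_compose[of "edge_iso e" integer_group _ h] by (auto simp: mon_def comp_def)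
    have "h (edge_iso e 1) \<in> range (basis v)"
      using hom basis_props(3)[OF v] by (auto simp: hom_def)
    then have z: "basis v z = h (edge_iso e 1)"
      unfolding z_def by (rule f_inv_into_f)
    have "(\<lambda>n. basis v (int_scale n z)) \<in> hom integer_group (vertex_group \<G> v)"
      using basis_props(4)[OF v] by (intro homI) (auto simp: basis_props(1)[OF v, symmetric] distrib_right)
    then have scale: "h (edge_iso e n) = basis v (int_scale n z)" for n
      using A.hom_integer_group_eq[OF hom, of n] A.hom_integer_group_eq[of "\<lambda>n. basis v (int_scale n z)" n] z
      by simp
    have "z \<noteq> 0"
    proof
      assume "z = 0"
      then have "h (edge_iso e 1) = h (edge_iso e 0)"
        using scale[of 1] scale[of 0] by simp
      moreover have "inj_on h (carrier (edge_group \<G> e))"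
        using h by (simp add: mon_def)
      moreover have "edge_iso e 1 \<in> carrier (edge_group \<G> e)" "edge_iso e 0 \<in> carrier (edge_group \<G> e)"
        using ei by (auto simp: hom_def)
      ultimately have "edge_iso e 1 = edge_iso e 0"
        by (auto dest: inj_onD)
      then show False
        using ei(2) by (auto dest: injD)
    qed
    with scale show ?thesis
      unfolding z_def by blast
  qed
  show "tail_map \<G> e (edge_iso e n) = basis (src e) (int_scale n (tail_vec e))" "tail_vec e \<noteq> 0"
    unfolding tail_vec_def using *[OF tail_map_mon[OF assms] ends_in_V(1)[OF assms]] by blast+
  show "head_map \<G> e (edge_iso e n) = basis (tgt e) (int_scale n (head_vec e))" "head_vec e \<noteq> 0"
    unfolding head_vec_def using *[OF head_map_mon[OF assms] ends_in_V(2)[OF assms]] by blast+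
qed

lemma stable_conj:
  assumes "e \<in> E"
  shows "stable e \<otimes>\<^bsub>P\<^esub> vertex_elt (tgt e) (int_scale n (head_vec e)) = vertex_elt (src e) (int_scale n (tail_vec e)) \<otimes>\<^bsub>P\<^esub> stable e"
proof -
  let ?t = "[(Stable_Letter e, True)]"
    and ?h = "[(Vertex_Elt (tgt e) (basis (tgt e) (int_scale n (head_vec e))), True)]"
    and ?s = "[(Vertex_Elt (src e) (basis (src e) (int_scale n (tail_vec e))), True)]"
  have W: "?t \<in> words gens" "?h \<in> words gens" "?s \<in> words gens"
    using assms ends_in_V stable_letter_in_words vertex_letter_in_words by auto
  have "edge_iso e n \<in> carrier (edge_group \<G> e)"
    using edge_iso[OF assms] by (auto simp: iso_def hom_def)
  then have "?t @ ?h @ inv_word ?t @ inv_word ?s \<in> rels"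
    unfolding edge_map_scale(1,2)[OF assms, symmetric] gog_relators_def using assms by auto
  then have "cls (?t @ ?h @ inv_word ?t @ inv_word ?s) = \<one>\<^bsub>P\<^esub>"
    using W by (intro cls_relator) auto
  then have "cls ?t \<otimes>\<^bsub>P\<^esub> (cls ?h \<otimes>\<^bsub>P\<^esub> (inv\<^bsub>P\<^esub> cls ?t \<otimes>\<^bsub>P\<^esub> inv\<^bsub>P\<^esub> cls ?s)) = \<one>\<^bsub>P\<^esub>"
    using W by (simp only: cls_append cls_inv inv_word_in_words words_simps)
  then have "(cls ?t \<otimes>\<^bsub>P\<^esub> cls ?h) \<otimes>\<^bsub>P\<^esub> inv\<^bsub>P\<^esub> (cls ?s \<otimes>\<^bsub>P\<^esub> cls ?t) = \<one>\<^bsub>P\<^esub>"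
    using W[THEN cls_closed] by (simp only: P.m_assoc P.inv_mult_group P.m_closed P.inv_closed)
  then have "cls ?t \<otimes>\<^bsub>P\<^esub> cls ?h = cls ?s \<otimes>\<^bsub>P\<^esub> cls ?t"
    by (rule P.eq_of_mult_inv_eq_one[OF P.m_closed[OF cls_closed[OF W(1)] cls_closed[OF W(2)]]
        P.m_closed[OF cls_closed[OF W(3)] cls_closed[OF W(1)]]])
  then show ?thesis
    by (simp add: vertex_elt_def stable_def)
qed

section \<open>Affine representations\<close>

text \<open>Let each vertex group \<open>\<int>\<^sup>2\<close> act on the plane by translations, and the stable letter of \<open>e\<close> by any
  additive bijection that carries \<open>head_vec e\<close> to \<open>tail_vec e\<close>. Conjugation by an additive bijection
  turns the translation by a vector into the translation by its image, so the relators hold.\<close>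

lemma plane_representation:
  assumes M: "\<And>e. e \<in> E \<Longrightarrow> bij (M e)" "\<And>e y z. e \<in> E \<Longrightarrow> M e (y + z) = M e y + M e z"
    "\<And>e. e \<in> E \<Longrightarrow> M e (cplx (head_vec e)) = cplx (tail_vec e)"
  obtains \<Phi> where "\<Phi> \<in> hom P bijections"
    and "\<And>v z. v \<in> V \<Longrightarrow> \<Phi> (vertex_elt v z) = (\<lambda>x. cplx z + x)"
    and "\<And>e. e \<in> E \<Longrightarrow> \<Phi> (stable e) = M e"
proof -
  interpret B: group "bijections :: (complex \<Rightarrow> complex) monoid"
    by (rule group_bijections)
  define \<phi> where "\<phi> g = (case g of Vertex_Elt v a \<Rightarrow> (\<lambda>x. cplx (inv_into UNIV (basis v) a) + x)
    | Stable_Letter e \<Rightarrow> M e)" for g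
  have bij_translation: "bij (\<lambda>x. c + x)" for c :: complex
    by (rule o_bij[of "\<lambda>x. x - c"]) (auto simp: comp_def)
  have \<phi>_basis: "\<phi> (Vertex_Elt v (basis v z)) = (\<lambda>x. cplx z + x)" if "v \<in> V" for v z
    using basis_props(2)[OF that] by (simp add: \<phi>_def)
  have \<phi>_stable: "\<phi> (Stable_Letter e) = M e" for e
    by (simp add: \<phi>_def)
  have \<phi>: "\<phi> \<in> gens \<rightarrow> carrier bijections"
    using bij_translation M(1) by (auto simp: gog_generators_def \<phi>_def)
  have rel_vertex: "word_eval bijections \<phi> [(x, True), (y, True), (z, False)] = \<one>\<^bsub>bijections\<^esub>"
    if "\<phi> x \<circ> \<phi> y = \<phi> z" "bij (\<phi> x)" "bij (\<phi> y)" "bij (\<phi> z)" for x y z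
    using that B.r_inv[of "\<phi> z"] by (simp flip: comp_assoc)
  have rel_stable: "word_eval bijections \<phi> [(x, True), (y, True), (x, False), (z, False)] = \<one>\<^bsub>bijections\<^esub>"
    if "\<phi> x \<circ> \<phi> y = \<phi> z \<circ> \<phi> x" "bij (\<phi> x)" "bij (\<phi> y)" "bij (\<phi> z)" for x y z
  proof -
    have "\<phi> x \<otimes>\<^bsub>bijections\<^esub> (\<phi> y \<otimes>\<^bsub>bijections\<^esub> (inv\<^bsub>bijections\<^esub> \<phi> x \<otimes>\<^bsub>bijections\<^esub> inv\<^bsub>bijections\<^esub> \<phi> z))
        = (\<phi> x \<otimes>\<^bsub>bijections\<^esub> \<phi> y) \<otimes>\<^bsub>bijections\<^esub> inv\<^bsub>bijections\<^esub> (\<phi> z \<otimes>\<^bsub>bijections\<^esub> \<phi> x)"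
      using that B.m_assoc B.inv_mult_group B.inv_closed B.m_closed unfolding bijections_simps(1)[symmetric]
      by metis
    also have "\<dots> = \<one>\<^bsub>bijections\<^esub>"
      using that(1) B.r_inv[of "\<phi> x \<circ> \<phi> y"] bij_comp[OF that(3,2)] by simp
    finally show ?thesis
      by simp
  qed
  have rel: "word_eval bijections \<phi> r = \<one>\<^bsub>bijections\<^esub>" if "r \<in> rels" "r \<in> words gens" for r
    using that(1) unfolding gog_relators_def
  proof (elim UnE CollectE exE conjE)
    fix v a b
    assume r: "r = [(Vertex_Elt v a, True), (Vertex_Elt v b, True),
        (Vertex_Elt v (a \<otimes>\<^bsub>vertex_group \<G> v\<^esub> b), False)]"
      and v: "v \<in> V" and ab: "a \<in> carrier (vertex_group \<G> v)" "b \<in> carrier (vertex_group \<G> v)"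
    obtain y z where yz: "a = basis v y" "b = basis v z"
      using ab basis_props(3)[OF v] by blast
    show ?thesis
      unfolding r yz basis_props(1)[OF v, symmetric]
      using v bij_translation by (intro rel_vertex) (auto simp: \<phi>_basis fun_eq_iff)
  next
    fix e c
    assume r: "r = [(Stable_Letter e, True), (Vertex_Elt (tgt e) (head_map \<G> e c), True),
        (Stable_Letter e, False), (Vertex_Elt (src e) (tail_map \<G> e c), False)]"
      and e: "e \<in> E" and c: "c \<in> carrier (edge_group \<G> e)"
    obtain n where n: "c = edge_iso e n"
      using c edge_iso[OF e] by (auto simp: iso_def bij_betw_def)
    have M_scale: "M e (cplx (int_scale n (head_vec e))) = cplx (int_scale n (tail_vec e))"
    proof -
      have M0: "M e 0 = 0"
        using M(2)[OF e, of 0 0] by simp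
      have nat: "M e (of_nat k * w) = of_nat k * M e w" for k w
        by (induction k) (simp_all add: M0 M(2)[OF e] distrib_right)
      have "M e (- w) = - M e w" for w
        using M(2)[OF e, of w "- w"] M0 by (simp add: add_eq_0_iff)
      then have int: "M e (of_int k * w) = of_int k * M e w" for k w
        using nat by (cases k rule: int_cases2) simp_all
      have "cplx (int_scale n z) = of_int n * cplx z" for z
        by (simp add: cplx_def complex_eq_iff)
      then show ?thesis
        using int[of n "cplx (head_vec e)"] M(3)[OF e] by simp
    qed
    show ?thesis
      unfolding r n edge_map_scale(1,2)[OF e]
      using e M(1) bij_translation M_scale
      by (intro rel_stable) (auto simp: \<phi>_basis \<phi>_stable ends_in_V fun_eq_iff M(2))
  qed
  obtain \<Phi> where \<Phi>: "\<Phi> \<in> hom P bijections"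
    "\<And>w. w \<in> words gens \<Longrightarrow> \<Phi> (cls w) = word_eval bijections \<phi> w"
    using B.presented_group_lift[OF \<phi> rel] unfolding P_def by blast
  show ?thesis
  proof (rule that[OF \<Phi>(1)])
    show "\<Phi> (vertex_elt v z) = (\<lambda>x. cplx z + x)" if "v \<in> V" for v z
      using that by (simp add: vertex_elt_def \<Phi>(2) vertex_letter_in_words \<phi>_basis)
    show "\<Phi> (stable e) = M e" if "e \<in> E" for e
      using that by (simp add: stable_def \<Phi>(2) stable_letter_in_words \<phi>_stable)
  qed
qed

lemma bij_mult_div:
  fixes c d :: complex
  assumes "c \<noteq> 0" "d \<noteq> 0"
  shows "bij (\<lambda>x. x * c / d)"
  using assms by (intro o_bij[of "\<lambda>x. x * d / c"]) (auto simp: comp_def)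

text \<open>At a single arc the additive bijection may be prescribed on a second vector: it can send \<open>y\<close> to
  \<open>- x\<close>. Then \<open>x t y\<inverse> t\<inverse>\<close> acts as the translation by \<open>2 x\<close>, which is independent of the edge vector.\<close>

lemma plane_representation_at_edge:
  assumes e: "e \<in> E" and x: "cross (tail_vec e) x \<noteq> 0" and y: "cross (head_vec e) y \<noteq> 0"
  obtains \<Phi> where "\<Phi> \<in> hom P bijections"
    and "\<And>v z. v \<in> V \<Longrightarrow> \<Phi> (vertex_elt v z) = (\<lambda>x. cplx z + x)"
    and "\<And>z. \<Phi> (stable e) (cplx y + z) = \<Phi> (stable e) z - cplx x"
proof -
  have "cross (tail_vec e) (- x) \<noteq> 0"
    using x by (simp add: cross_def)
  from exists_additive_bijection[OF y this]
  obtain N where N: "bij N" "\<And>y z. N (y + z) = N y + N z" "N (cplx (head_vec e)) = cplx (tail_vec e)"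
    "N (cplx y) = cplx (- x)"
    by blast
  define M where "M e' = (if e' = e then N else (\<lambda>x. x * cplx (tail_vec e') / cplx (head_vec e')))" for e'
  obtain \<Phi> where "\<Phi> \<in> hom P bijections" "\<And>v z. v \<in> V \<Longrightarrow> \<Phi> (vertex_elt v z) = (\<lambda>x. cplx z + x)"
    "\<And>e. e \<in> E \<Longrightarrow> \<Phi> (stable e) = M e"
  proof (rule plane_representation[of M])
    show "bij (M e')" if "e' \<in> E" for e'
      using N(1) edge_map_scale(3,4)[OF that] by (auto simp: M_def intro!: bij_mult_div)
    show "M e' (y + z) = M e' y + M e' z" for e' y z
      using N(2) by (simp add: M_def algebra_simps add_divide_distrib)
    show "M e' (cplx (head_vec e')) = cplx (tail_vec e')" if "e' \<in> E" for e'
      using N(3) edge_map_scale(4)[OF that] by (auto simp: M_def)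
  qed blast
  then show ?thesis
    using that N(2,4) e by (simp add: M_def)
qed

text \<open>Vertex groups embed, since their elements act by distinct translations in any affine
  representation; one exists because complex multiplication by \<open>tail_vec e / head_vec e\<close> is a possible
  choice at every arc.\<close>

lemma vertex_elt_inj:
  assumes v: "v \<in> V" and "vertex_elt v z = \<one>\<^bsub>P\<^esub>"
  shows "z = 0"
proof -
  obtain \<Phi> where \<Phi>: "\<Phi> \<in> hom P bijections" "\<And>v z. v \<in> V \<Longrightarrow> \<Phi> (vertex_elt v z) = (\<lambda>x. cplx z + x)"
    by (rule plane_representation[of "\<lambda>e x. x * cplx (tail_vec e) / cplx (head_vec e)"])
      (use edge_map_scale(3,4) in \<open>auto intro!: bij_mult_div simp: algebra_simps add_divide_distrib\<close>)
  have "\<Phi> (vertex_elt v z) = id"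
    using assms(2) hom_one[OF \<Phi>(1) P.is_group group_bijections] by simp
  then show ?thesis
    using \<Phi>(2)[OF v, of z] by (metis add.right_neutral cplx_simps(4) id_apply)
qed

section \<open>Edge paths\<close>

text \<open>The elements of \<open>P\<close> spelled along paths. Those starting at a base point \<open>v\<^sub>0\<close> and ending at \<open>w\<close> form a
  set on which, unless it is empty, the fundamental group at \<open>v\<^sub>0\<close> acts simply transitively from the left, and its quotient
  by the vertex group at \<open>w\<close> is the set of vertices over \<open>w\<close> of the Bass--Serre tree.\<close>

definition paths :: "'v \<Rightarrow> 'v \<Rightarrow> ('v, 'e, 'a) gog_generator word set set"
  where "paths v w = {cls p | p. gog_path \<G> v p w}"

lemma gog_path_verts: "gog_path \<G> v p w \<Longrightarrow> v \<in> V \<and> w \<in> V"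
  by (induction rule: gog_path.induct) (auto intro: ends_in_V)

lemma gog_path_words: "gog_path \<G> v p w \<Longrightarrow> p \<in> words gens"
  by (induction rule: gog_path.induct) (auto dest: gog_path_verts simp: gog_generators_def)

lemma gog_path_append:
  "gog_path \<G> u p v \<Longrightarrow> gog_path \<G> v q w \<Longrightarrow> gog_path \<G> u (p @ q) w"
  by (induction rule: gog_path.induct) (auto intro: gog_path.intros)

lemma paths_closed [simp]: "g \<in> paths v w \<Longrightarrow> g \<in> carrier P"
  using gog_path_words cls_closed by (auto simp: paths_def)

lemma paths_verts: "g \<in> paths v w \<Longrightarrow> v \<in> V \<and> w \<in> V"
  using gog_path_verts by (auto simp: paths_def)

lemma paths_mult [intro]:
  "g \<in> paths u v \<Longrightarrow> h \<in> paths v w \<Longrightarrow> g \<otimes>\<^bsub>P\<^esub> h \<in> paths u w"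
proof -
  assume "g \<in> paths u v" "h \<in> paths v w"
  then obtain p q where pq: "gog_path \<G> u p v" "gog_path \<G> v q w" "g = cls p" "h = cls q"
    unfolding paths_def by blast
  then have "g \<otimes>\<^bsub>P\<^esub> h = cls (p @ q)"
    using cls_append[OF gog_path_words gog_path_words] by metis
  then show ?thesis
    unfolding paths_def using gog_path_append[OF pq(1,2)] by blast
qed

lemma pathsI: "gog_path \<G> v p w \<Longrightarrow> cls p \<in> paths v w"
  by (auto simp: paths_def)

lemma paths_one [intro]: "v \<in> V \<Longrightarrow> \<one>\<^bsub>P\<^esub> \<in> paths v v"
  unfolding P_def one_presented_group by (intro pathsI gog_path.Nil)

lemma paths_vertex_elt [intro]: "v \<in> V \<Longrightarrow> vertex_elt v z \<in> paths v v"
  unfolding vertex_elt_def by (intro pathsI gog_path.Vertex gog_path.Nil basis_props(4))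

lemma paths_stable [intro]: "e \<in> E \<Longrightarrow> stable e \<in> paths (src e) (tgt e)"
  unfolding stable_def by (intro pathsI gog_path.Forward gog_path.Nil ends_in_V)

lemma paths_stable_inv [intro]:
  assumes "e \<in> E"
  shows "inv\<^bsub>P\<^esub> stable e \<in> paths (tgt e) (src e)"
proof -
  have "cls [(Stable_Letter e, False)] \<in> paths (tgt e) (src e)"
    using assms by (intro pathsI gog_path.Backward gog_path.Nil ends_in_V)
  then show ?thesis
    using cls_inv[OF stable_letter_in_words[OF assms, of True]] by (simp add: stable_def)
qed

lemma paths_induct [consumes 1, case_names one vertex_elt stable stable_inv]:
  assumes "g \<in> paths v w"
    and "\<And>v. v \<in> V \<Longrightarrow> Q v \<one>\<^bsub>P\<^esub> v"
    and "\<And>v z g w. v \<in> V \<Longrightarrow> g \<in> paths v w \<Longrightarrow> Q v g w \<Longrightarrow> Q v (vertex_elt v z \<otimes>\<^bsub>P\<^esub> g) w"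
    and "\<And>e g w. e \<in> E \<Longrightarrow> g \<in> paths (tgt e) w \<Longrightarrow> Q (tgt e) g w \<Longrightarrow> Q (src e) (stable e \<otimes>\<^bsub>P\<^esub> g) w"
    and "\<And>e g w. e \<in> E \<Longrightarrow> g \<in> paths (src e) w \<Longrightarrow> Q (src e) g w \<Longrightarrow>
      Q (tgt e) (inv\<^bsub>P\<^esub> stable e \<otimes>\<^bsub>P\<^esub> g) w"
  shows "Q v g w"
proof -
  obtain p where p: "gog_path \<G> v p w" "g = cls p"
    using assms(1) by (auto simp: paths_def)
  have "Q v (cls p) w"
    using p(1)
  proof induction
    case (Nil v)
    then show ?case
      using assms(2) by (simp add: P_def one_presented_group)
  next
    case (Vertex a v p w)
    have v: "v \<in> V"
      using Vertex gog_path_verts by blast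
    then obtain z where z: "a = basis v z"
      using Vertex(1) basis_props(3) by blast
    have "cls ((Vertex_Elt v a, True) # p) = vertex_elt v z \<otimes>\<^bsub>P\<^esub> cls p"
      using cls_append[OF vertex_letter_in_words[OF v] gog_path_words[OF Vertex(2)]]
      by (simp add: vertex_elt_def z)
    then show ?case
      using assms(3)[OF v, of "cls p" w z] Vertex by (simp add: pathsI)
  next
    case (Forward e p w)
    have "cls ((Stable_Letter e, True) # p) = stable e \<otimes>\<^bsub>P\<^esub> cls p"
      using cls_append[OF stable_letter_in_words[OF Forward(1)] gog_path_words[OF Forward(2)]]
      by (simp add: stable_def)
    then show ?case
      using assms(4)[OF Forward(1), of "cls p" w] Forward by (simp add: pathsI)
  next
    case (Backward e p w)
    have "cls ((Stable_Letter e, False) # p) = inv\<^bsub>P\<^esub> stable e \<otimes>\<^bsub>P\<^esub> cls p"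
      using cls_append[OF stable_letter_in_words[OF Backward(1)] gog_path_words[OF Backward(2)]]
        cls_inv[OF stable_letter_in_words[OF Backward(1), of True]]
      by (simp add: stable_def)
    then show ?case
      using assms(5)[OF Backward(1), of "cls p" w] Backward by (simp add: pathsI)
  qed
  then show ?thesis
    using p by simp
qed

lemma paths_inv [intro]: "g \<in> paths v w \<Longrightarrow> inv\<^bsub>P\<^esub> g \<in> paths w v"
proof (induction rule: paths_induct)
  case (one v)
  then show ?case
    by (simp add: paths_one)
next
  case (vertex_elt v z g w)
  then have "inv\<^bsub>P\<^esub> (vertex_elt v z \<otimes>\<^bsub>P\<^esub> g) = inv\<^bsub>P\<^esub> g \<otimes>\<^bsub>P\<^esub> vertex_elt v (- z)"
    by (simp add: P.inv_mult_group vertex_elt_uminus)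
  with vertex_elt show ?case
    using paths_vertex_elt by auto
next
  case (stable e g w)
  then show ?case
    using paths_stable_inv by (auto simp: P.inv_mult_group)
next
  case (stable_inv e g w)
  then show ?case
    using paths_stable by (auto simp: P.inv_mult_group)
qed

end

section \<open>A homomorphism with free kernel kills no edge group\<close>

lemma cross_zero_dependent:
  assumes "cross c x = 0" "c \<noteq> 0"
  obtains s t where "t \<noteq> 0" "int_scale t x = int_scale s c"
proof (cases "fst c = 0")
  case True
  then have "snd c \<noteq> 0"
    using assms(2) by (simp add: prod_eq_iff)
  then show ?thesis
    using that[of "snd c" "snd x"] assms(1) True by (auto simp: cross_def mult.commute)
next
  case False
  then show ?thesis
    using that[of "fst c" "fst x"] assms(1) by (auto simp: cross_def mult.commute)
qed

text \<open>A subgroup \<open>H\<close> of finite index in the fundamental group at \<open>v\<^sub>0\<close>, with coset representatives \<open>D\<close>, and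
  a homomorphism \<open>f\<close> from \<open>H\<close> to \<open>\<int>\<close> whose kernel contains no \<open>\<int>\<^sup>2\<close>. As \<open>f\<close> is a function on all of
  \<open>P\<close>, only its values on \<open>H\<close> are meaningful.\<close>

locale tubular_finite_index_subgroup = tubular_graph_of_groups \<G> basis edge_iso
  for \<G> :: "('v, 'e, 'a, 'b) graph_of_groups" and basis edge_iso +
  fixes v\<^sub>0 :: 'v and H D :: "('v, 'e, 'a) gog_generator word set set"
    and f :: "('v, 'e, 'a) gog_generator word set \<Rightarrow> int"
  assumes H: "subgroup H P" and H_paths: "H \<subseteq> paths v\<^sub>0 v\<^sub>0"
    and finite_D: "finite D" and D_paths: "D \<subseteq> paths v\<^sub>0 v\<^sub>0"
    and cover: "g \<in> paths v\<^sub>0 v\<^sub>0 \<Longrightarrow> \<exists>h\<in>H. \<exists>d\<in>D. g = h \<otimes>\<^bsub>P\<^esub> d"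
    and f_mult: "x \<in> H \<Longrightarrow> y \<in> H \<Longrightarrow> f (x \<otimes>\<^bsub>P\<^esub> y) = f x + f y"
    and dependent: "x \<in> H \<Longrightarrow> y \<in> H \<Longrightarrow> f x = 0 \<Longrightarrow> f y = 0 \<Longrightarrow> x \<otimes>\<^bsub>P\<^esub> y = y \<otimes>\<^bsub>P\<^esub> x \<Longrightarrow>
      \<exists>(i::int) (j::int). (i, j) \<noteq> (0, 0) \<and> x [^]\<^bsub>P\<^esub> i \<otimes>\<^bsub>P\<^esub> y [^]\<^bsub>P\<^esub> j = \<one>\<^bsub>P\<^esub>"
begin

sublocale H: subgroup H P
  by (rule H)

lemma f_one [simp]: "f \<one>\<^bsub>P\<^esub> = 0"
  using f_mult[of "\<one>\<^bsub>P\<^esub>" "\<one>\<^bsub>P\<^esub>"] by simp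

lemma f_inv: "x \<in> H \<Longrightarrow> f (inv\<^bsub>P\<^esub> x) = - f x"
  using f_mult[of x "inv\<^bsub>P\<^esub> x"] by simp

lemma H_pow: "x \<in> H \<Longrightarrow> x [^]\<^bsub>P\<^esub> (n::int) \<in> H"
  using P.subgroup_int_pow_closed[OF H] by simp

lemma f_pow:
  assumes "x \<in> H" shows "f (x [^]\<^bsub>P\<^esub> n) = n * f x"
proof -
  have "(\<lambda>n. f (x [^]\<^bsub>P\<^esub> n)) \<in> hom integer_group integer_group"
    using assms by (intro homI) (auto simp: P.int_pow_mult f_mult H_pow)
  from group.hom_integer_group_eq[OF group_integer_group this, of n] show ?thesis
    using assms by simp
qed

text \<open>Infinitely many powers of \<open>g\<close> lie in the finitely many cosets of \<open>H\<close>.\<close>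

lemma power_in_H:
  assumes g: "g \<in> paths v\<^sub>0 v\<^sub>0"
  obtains n :: int where "n > 0" "g [^]\<^bsub>P\<^esub> n \<in> H"
proof -
  have gP: "g \<in> carrier P"
    using g by simp
  have pow: "g [^]\<^bsub>P\<^esub> n \<in> paths v\<^sub>0 v\<^sub>0" for n :: int
  proof -
    have nat: "x [^]\<^bsub>P\<^esub> k \<in> paths v\<^sub>0 v\<^sub>0" if "x \<in> paths v\<^sub>0 v\<^sub>0" for x and k :: nat
      using that paths_verts[OF that] by (induction k) auto
    show ?thesis
      using nat[OF g] nat[OF g, THEN paths_inv] by (simp add: int_pow_def2 del: pow_nat)
  qed
  have "\<exists>d\<in>D. g [^]\<^bsub>P\<^esub> n \<otimes>\<^bsub>P\<^esub> inv\<^bsub>P\<^esub> d \<in> H" for n :: int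
  proof -
    obtain h d where h: "h \<in> H" "d \<in> D" "g [^]\<^bsub>P\<^esub> n = h \<otimes>\<^bsub>P\<^esub> d"
      using cover[OF pow] by blast
    then have "d \<in> carrier P"
      using D_paths by auto
    then have "g [^]\<^bsub>P\<^esub> n \<otimes>\<^bsub>P\<^esub> inv\<^bsub>P\<^esub> d = h"
      using h by (simp add: P.m_assoc)
    then show ?thesis
      using h(1,2) by metis
  qed
  then obtain F where F: "\<And>n. F n \<in> D" "\<And>n::int. g [^]\<^bsub>P\<^esub> n \<otimes>\<^bsub>P\<^esub> inv\<^bsub>P\<^esub> F n \<in> H"
    by metis
  obtain m n where mn: "m \<noteq> n" "F m = F n"
    by (rule finite_set_imp_int_collision[OF finite_D, where F = F, OF F(1)])
  have d: "F n \<in> carrier P"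
    using F(1)[of n] D_paths paths_closed by blast
  have "(g [^]\<^bsub>P\<^esub> m \<otimes>\<^bsub>P\<^esub> inv\<^bsub>P\<^esub> F n) \<otimes>\<^bsub>P\<^esub> inv\<^bsub>P\<^esub> (g [^]\<^bsub>P\<^esub> n \<otimes>\<^bsub>P\<^esub> inv\<^bsub>P\<^esub> F n) \<in> H"
    using F(2)[of m] F(2)[of n] mn by simp
  also have "(g [^]\<^bsub>P\<^esub> m \<otimes>\<^bsub>P\<^esub> inv\<^bsub>P\<^esub> F n) \<otimes>\<^bsub>P\<^esub> inv\<^bsub>P\<^esub> (g [^]\<^bsub>P\<^esub> n \<otimes>\<^bsub>P\<^esub> inv\<^bsub>P\<^esub> F n)
      = g [^]\<^bsub>P\<^esub> m \<otimes>\<^bsub>P\<^esub> ((inv\<^bsub>P\<^esub> F n \<otimes>\<^bsub>P\<^esub> F n) \<otimes>\<^bsub>P\<^esub> inv\<^bsub>P\<^esub> (g [^]\<^bsub>P\<^esub> n))"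
    using d gP by (simp only: P.inv_mult_group P.m_assoc P.inv_closed P.m_closed P.int_pow_closed P.inv_inv)
  also have "\<dots> = g [^]\<^bsub>P\<^esub> (m - n)"
    using d gP by (simp add: P.int_pow_diff)
  finally have "g [^]\<^bsub>P\<^esub> (m - n) \<in> H" .
  moreover from this have "g [^]\<^bsub>P\<^esub> (n - m) \<in> H"
    using gP H.m_inv_closed P.int_pow_neg[OF gP, of "m - n"] by simp
  ultimately show ?thesis
    using mn(1) that[of "m - n"] that[of "n - m"] by (cases "m > n") auto
qed

text \<open>For a path \<open>g\<close> from \<open>v\<^sub>0\<close> to \<open>v\<close> these elements form the stabilizer of the vertex of the Bass--Serre tree
  that \<open>g\<close> represents.\<close>

definition conj_elt where "conj_elt g v z = g \<otimes>\<^bsub>P\<^esub> vertex_elt v z \<otimes>\<^bsub>P\<^esub> inv\<^bsub>P\<^esub> g"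

lemma conj_elt_paths: "g \<in> paths v\<^sub>0 v \<Longrightarrow> conj_elt g v z \<in> paths v\<^sub>0 v\<^sub>0"
  unfolding conj_elt_def using paths_verts by blast

lemma conj_elt_closed [simp]: "g \<in> paths v\<^sub>0 v \<Longrightarrow> conj_elt g v z \<in> carrier P"
  using conj_elt_paths paths_closed by blast

lemma conj_elt_add:
  assumes "g \<in> paths v\<^sub>0 v" shows "conj_elt g v (y + z) = conj_elt g v y \<otimes>\<^bsub>P\<^esub> conj_elt g v z"
proof -
  have c: "v \<in> V" "g \<in> carrier P" "vertex_elt v y \<in> carrier P" "vertex_elt v z \<in> carrier P"
    using assms paths_verts[OF assms] by auto
  have "conj_elt g v y \<otimes>\<^bsub>P\<^esub> conj_elt g v z
      = g \<otimes>\<^bsub>P\<^esub> (vertex_elt v y \<otimes>\<^bsub>P\<^esub> ((inv\<^bsub>P\<^esub> g \<otimes>\<^bsub>P\<^esub> g) \<otimes>\<^bsub>P\<^esub> (vertex_elt v z \<otimes>\<^bsub>P\<^esub> inv\<^bsub>P\<^esub> g)))"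
    unfolding conj_elt_def using c by (simp only: P.m_assoc P.m_closed P.inv_closed)
  then show ?thesis
    using c by (simp add: conj_elt_def vertex_elt_add P.m_assoc)
qed

lemma conj_elt_scale:
  assumes "g \<in> paths v\<^sub>0 v" shows "conj_elt g v (int_scale n z) = conj_elt g v z [^]\<^bsub>P\<^esub> n"
  using assms paths_verts[OF assms] P.conj_int_pow[of g "vertex_elt v z" n]
  unfolding conj_elt_def by (simp add: vertex_elt_scale)

lemma conj_elt_comm: "g \<in> paths v\<^sub>0 v \<Longrightarrow> conj_elt g v y \<otimes>\<^bsub>P\<^esub> conj_elt g v z = conj_elt g v z \<otimes>\<^bsub>P\<^esub> conj_elt g v y"
  by (simp add: add.commute flip: conj_elt_add)

lemma conj_elt_uminus:
  assumes "g \<in> paths v\<^sub>0 v" shows "conj_elt g v (- z) = inv\<^bsub>P\<^esub> conj_elt g v z"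
proof -
  have "- z = int_scale (- 1) z"
    by (simp add: prod_eq_iff)
  then show ?thesis
    using conj_elt_scale[OF assms, of "- 1" z] assms by (simp add: P.int_pow_neg)
qed

lemma conj_eq_one:
  assumes "g \<in> carrier P" "x \<in> carrier P" "g \<otimes>\<^bsub>P\<^esub> x \<otimes>\<^bsub>P\<^esub> inv\<^bsub>P\<^esub> g = \<one>\<^bsub>P\<^esub>"
  shows "x = \<one>\<^bsub>P\<^esub>"
  using P.eq_of_mult_inv_eq_one[of "g \<otimes>\<^bsub>P\<^esub> x" g] assms by simp

lemma conj_elt_eq_one:
  assumes "g \<in> paths v\<^sub>0 v" "conj_elt g v z = \<one>\<^bsub>P\<^esub>" shows "z = 0"
  using conj_eq_one[of g "vertex_elt v z"] vertex_elt_inj[of v z] assms paths_verts[OF assms(1)]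
  unfolding conj_elt_def by simp

lemma conj_elt_scale_in_H:
  assumes "g \<in> paths v\<^sub>0 v"
  obtains n where "n > 0" "conj_elt g v (int_scale n z) \<in> H"
  using power_in_H[OF conj_elt_paths[OF assms, of z]] conj_elt_scale[OF assms, of _ z] by metis

text \<open>Otherwise powers of a basis of the vertex group \<open>\<int>\<^sup>2\<close> would be independent commuting elements of the
  kernel.\<close>

lemma vertex_group_not_killed:
  assumes g: "g \<in> paths v\<^sub>0 v"
  obtains z where "conj_elt g v z \<in> H" "f (conj_elt g v z) \<noteq> 0"
proof (rule ccontr)
  assume not: "\<not> thesis"
  have killed: "conj_elt g v z \<in> H \<Longrightarrow> f (conj_elt g v z) = 0" for z
    using not that by blast
  obtain m where m: "m > 0" "conj_elt g v (int_scale m (1, 0)) \<in> H"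
    by (rule conj_elt_scale_in_H[OF g])
  obtain n where n: "n > 0" "conj_elt g v (int_scale n (0, 1)) \<in> H"
    by (rule conj_elt_scale_in_H[OF g])
  obtain i j :: int where ij: "(i, j) \<noteq> (0, 0)"
    "conj_elt g v (int_scale m (1, 0)) [^]\<^bsub>P\<^esub> i \<otimes>\<^bsub>P\<^esub> conj_elt g v (int_scale n (0, 1)) [^]\<^bsub>P\<^esub> j = \<one>\<^bsub>P\<^esub>"
    using dependent[OF m(2) n(2) killed[OF m(2)] killed[OF n(2)] conj_elt_comm[OF g]] by blast
  have "conj_elt g v (int_scale i (int_scale m (1, 0)) + int_scale j (int_scale n (0, 1))) = \<one>\<^bsub>P\<^esub>"
    using ij(2) by (simp only: conj_elt_add[OF g] conj_elt_scale[OF g])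
  then have "int_scale i (int_scale m (1, 0)) + int_scale j (int_scale n (0, 1)) = 0"
    by (rule conj_elt_eq_one[OF g])
  then show False
    using m(1) n(1) ij(1) by (simp add: zero_prod_def)
qed

text \<open>A dependence of \<open>x\<close> on a vector \<open>c\<close> that \<open>f\<close> kills would make a multiple of \<open>f x\<close> vanish.\<close>

lemma killed_independent:
  assumes g: "g \<in> paths v\<^sub>0 v" and c: "c \<noteq> 0" "n \<noteq> 0"
    and cH: "conj_elt g v (int_scale n c) \<in> H" "f (conj_elt g v (int_scale n c)) = 0"
    and x: "conj_elt g v x \<in> H" "f (conj_elt g v x) \<noteq> 0"
  shows "cross c x \<noteq> 0"
proof
  assume "cross c x = 0"
  then obtain s t where st: "t \<noteq> 0" "int_scale t x = int_scale s c"
    using c(1) by (rule cross_zero_dependent)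
  have "int_scale (n * t) x = int_scale s (int_scale n c)"
    using st(2) by (simp add: mult.assoc mult.left_commute)
  then have "conj_elt g v x [^]\<^bsub>P\<^esub> (n * t) = conj_elt g v (int_scale n c) [^]\<^bsub>P\<^esub> s"
    using conj_elt_scale[OF g, of "n * t" x] conj_elt_scale[OF g, of s "int_scale n c"] by metis
  then have "(n * t) * f (conj_elt g v x) = s * f (conj_elt g v (int_scale n c))"
    using f_pow[OF x(1)] f_pow[OF cH(1)] by metis
  then show False
    using st(1) c(2) cH(2) x(2) by simp
qed

lemma conj_elt_across_edge:
  assumes e: "e \<in> E" and g: "g \<in> paths v\<^sub>0 (src e)"
  shows "conj_elt (g \<otimes>\<^bsub>P\<^esub> stable e) (tgt e) (int_scale n (head_vec e)) = conj_elt g (src e) (int_scale n (tail_vec e))"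
proof -
  have c: "g \<in> carrier P" "stable e \<in> carrier P"
    "vertex_elt (tgt e) (int_scale n (head_vec e)) \<in> carrier P" "vertex_elt (src e) (int_scale n (tail_vec e)) \<in> carrier P"
    using g e ends_in_V by auto
  have "conj_elt (g \<otimes>\<^bsub>P\<^esub> stable e) (tgt e) (int_scale n (head_vec e))
      = g \<otimes>\<^bsub>P\<^esub> (stable e \<otimes>\<^bsub>P\<^esub> vertex_elt (tgt e) (int_scale n (head_vec e))) \<otimes>\<^bsub>P\<^esub> (inv\<^bsub>P\<^esub> stable e \<otimes>\<^bsub>P\<^esub> inv\<^bsub>P\<^esub> g)"
    unfolding conj_elt_def using c by (simp only: P.m_assoc P.m_closed P.inv_closed P.inv_mult_group)
  also have "\<dots> = g \<otimes>\<^bsub>P\<^esub> vertex_elt (src e) (int_scale n (tail_vec e)) \<otimes>\<^bsub>P\<^esub> ((stable e \<otimes>\<^bsub>P\<^esub> inv\<^bsub>P\<^esub> stable e) \<otimes>\<^bsub>P\<^esub> inv\<^bsub>P\<^esub> g)"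
    unfolding stable_conj[OF e] using c by (simp only: P.m_assoc P.m_closed P.inv_closed P.inv_mult_group)
  also have "\<dots> = conj_elt g (src e) (int_scale n (tail_vec e))"
    using c by (simp add: conj_elt_def)
  finally show ?thesis .
qed

text \<open>Suppose that \<open>f\<close> kills the edge group of \<open>e\<close>. It does not kill the vertex groups at
  the two ends, so there are \<open>x\<close> and \<open>y\<close> in them with equal nonzero image. The quotient \<open>\<kappa>\<close> of the
  two elements then lies in the kernel, and it commutes with the edge group, because both vertex
  groups are commutative. As the kernel contains no \<open>\<int>\<^sup>2\<close>, \<open>\<kappa>\<close> is dependent on the
  generator of the edge group. But there is an affine representation in which, up to conjugation
  by \<open>g\<close>, the two act as translations by independent vectors.\<close>

lemma edge_group_not_killed:
  assumes e: "e \<in> E" and g: "g \<in> paths v\<^sub>0 (src e)"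
  obtains n where "conj_elt g (src e) (int_scale n (tail_vec e)) \<in> H"
    "f (conj_elt g (src e) (int_scale n (tail_vec e))) \<noteq> 0"
proof (rule ccontr)
  assume not: "\<not> thesis"
  define c where "c = tail_vec e"
  define g' where "g' = g \<otimes>\<^bsub>P\<^esub> stable e"
  have g': "g' \<in> paths v\<^sub>0 (tgt e)"
    unfolding g'_def using g e by blast
  obtain n where n: "n > 0" "conj_elt g (src e) (int_scale n c) \<in> H"
    by (rule conj_elt_scale_in_H[OF g])
  define z where "z = conj_elt g (src e) (int_scale n c)"
  have z: "z \<in> H" "f z = 0" "z = conj_elt g' (tgt e) (int_scale n (head_vec e))"
    using n(2) not that conj_elt_across_edge[OF e g] by (auto simp: z_def c_def g'_def)
  obtain x0 where x0: "conj_elt g (src e) x0 \<in> H" "f (conj_elt g (src e) x0) \<noteq> 0"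
    by (rule vertex_group_not_killed[OF g])
  obtain y0 where y0: "conj_elt g' (tgt e) y0 \<in> H" "f (conj_elt g' (tgt e) y0) \<noteq> 0"
    by (rule vertex_group_not_killed[OF g'])
  \<comment> \<open>Cross-multiplication makes the two images equal.\<close>
  define x where "x = int_scale (f (conj_elt g' (tgt e) y0)) x0"
  define y where "y = int_scale (f (conj_elt g (src e) x0)) y0"
  have x: "conj_elt g (src e) x \<in> H" "f (conj_elt g (src e) x) = f (conj_elt g' (tgt e) y0) * f (conj_elt g (src e) x0)"
    using x0 by (simp_all add: x_def conj_elt_scale[OF g] H_pow f_pow)
  have y: "conj_elt g' (tgt e) y \<in> H" "f (conj_elt g' (tgt e) y) = f (conj_elt g' (tgt e) y0) * f (conj_elt g (src e) x0)"
    using y0 by (simp_all add: y_def conj_elt_scale[OF g'] H_pow f_pow)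
  have cross: "cross c x \<noteq> 0" "cross (head_vec e) y \<noteq> 0"
  proof -
    show "cross c x \<noteq> 0"
      using killed_independent[OF g, of c n x] n z x x0(2) y0(2) edge_map_scale(3)[OF e]
      by (simp add: z_def c_def)
    show "cross (head_vec e) y \<noteq> 0"
      using killed_independent[OF g', of "head_vec e" n y] n z y x0(2) y0(2) edge_map_scale(4)[OF e]
      by simp
  qed
  \<comment> \<open>\<open>\<kappa>\<close> and \<open>z\<close> are the conjugates by \<open>g\<close> of \<open>\<tau>\<close> and \<open>w\<close>, whose action on the plane is known.\<close>
  define \<tau> where "\<tau> = vertex_elt (src e) x \<otimes>\<^bsub>P\<^esub> inv\<^bsub>P\<^esub> (stable e \<otimes>\<^bsub>P\<^esub> vertex_elt (tgt e) y \<otimes>\<^bsub>P\<^esub> inv\<^bsub>P\<^esub> stable e)"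
  define w where "w = vertex_elt (src e) (int_scale n c)"
  have V: "src e \<in> V" "tgt e \<in> V"
    using e ends_in_V by auto
  have closed: "g \<in> carrier P" "stable e \<in> carrier P" "vertex_elt (src e) x \<in> carrier P" "vertex_elt (tgt e) y \<in> carrier P"
    "\<tau> \<in> carrier P" "w \<in> carrier P"
    using V g e by (auto simp: \<tau>_def w_def)
  define \<kappa> where "\<kappa> = conj_elt g (src e) x \<otimes>\<^bsub>P\<^esub> inv\<^bsub>P\<^esub> conj_elt g' (tgt e) y"
  have \<kappa>: "\<kappa> \<in> H" "f \<kappa> = 0"
    using x y by (simp_all add: \<kappa>_def f_mult f_inv)
  have \<kappa>_conj: "\<kappa> = g \<otimes>\<^bsub>P\<^esub> \<tau> \<otimes>\<^bsub>P\<^esub> inv\<^bsub>P\<^esub> g"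
  proof -
    have "\<kappa> = g \<otimes>\<^bsub>P\<^esub> (vertex_elt (src e) x \<otimes>\<^bsub>P\<^esub> ((inv\<^bsub>P\<^esub> g \<otimes>\<^bsub>P\<^esub> g) \<otimes>\<^bsub>P\<^esub> (stable e \<otimes>\<^bsub>P\<^esub> (inv\<^bsub>P\<^esub> vertex_elt (tgt e) y \<otimes>\<^bsub>P\<^esub> (inv\<^bsub>P\<^esub> stable e \<otimes>\<^bsub>P\<^esub> inv\<^bsub>P\<^esub> g)))))"
      unfolding \<kappa>_def conj_elt_def g'_def using closed
      by (simp only: P.m_assoc P.m_closed P.inv_closed P.inv_mult_group P.inv_inv)
    then show ?thesis
      using closed by (simp add: \<tau>_def P.m_assoc P.inv_mult_group)
  qed
  have "\<kappa> \<otimes>\<^bsub>P\<^esub> z = z \<otimes>\<^bsub>P\<^esub> \<kappa>"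
  proof -
    have zc: "z \<in> carrier P"
      using z(1) by simp
    have "inv\<^bsub>P\<^esub> conj_elt g' (tgt e) y \<otimes>\<^bsub>P\<^esub> z = z \<otimes>\<^bsub>P\<^esub> inv\<^bsub>P\<^esub> conj_elt g' (tgt e) y"
      unfolding z(3) conj_elt_uminus[OF g', symmetric] by (rule conj_elt_comm[OF g'])
    moreover have "conj_elt g (src e) x \<otimes>\<^bsub>P\<^esub> z = z \<otimes>\<^bsub>P\<^esub> conj_elt g (src e) x"
      unfolding z_def by (rule conj_elt_comm[OF g])
    moreover have "conj_elt g (src e) x \<in> carrier P" "inv\<^bsub>P\<^esub> conj_elt g' (tgt e) y \<in> carrier P"
      using g g' by auto
    ultimately show ?thesis
      unfolding \<kappa>_def using zc by (metis P.m_assoc)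
  qed
  then obtain i j :: int where ij: "(i, j) \<noteq> (0, 0)" "\<kappa> [^]\<^bsub>P\<^esub> i \<otimes>\<^bsub>P\<^esub> z [^]\<^bsub>P\<^esub> j = \<one>\<^bsub>P\<^esub>"
    using dependent[OF \<kappa>(1) z(1) \<kappa>(2) z(2)] by blast
  have "\<kappa> [^]\<^bsub>P\<^esub> i \<otimes>\<^bsub>P\<^esub> z [^]\<^bsub>P\<^esub> j = g \<otimes>\<^bsub>P\<^esub> (\<tau> [^]\<^bsub>P\<^esub> i \<otimes>\<^bsub>P\<^esub> w [^]\<^bsub>P\<^esub> j) \<otimes>\<^bsub>P\<^esub> inv\<^bsub>P\<^esub> g"
  proof -
    have "\<kappa> [^]\<^bsub>P\<^esub> i \<otimes>\<^bsub>P\<^esub> z [^]\<^bsub>P\<^esub> j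
        = (g \<otimes>\<^bsub>P\<^esub> \<tau> [^]\<^bsub>P\<^esub> i \<otimes>\<^bsub>P\<^esub> inv\<^bsub>P\<^esub> g) \<otimes>\<^bsub>P\<^esub> (g \<otimes>\<^bsub>P\<^esub> w [^]\<^bsub>P\<^esub> j \<otimes>\<^bsub>P\<^esub> inv\<^bsub>P\<^esub> g)"
      unfolding \<kappa>_conj z_def conj_elt_def w_def[symmetric] using closed by (simp only: P.conj_int_pow)
    also have "\<dots> = g \<otimes>\<^bsub>P\<^esub> (\<tau> [^]\<^bsub>P\<^esub> i \<otimes>\<^bsub>P\<^esub> ((inv\<^bsub>P\<^esub> g \<otimes>\<^bsub>P\<^esub> g) \<otimes>\<^bsub>P\<^esub> (w [^]\<^bsub>P\<^esub> j \<otimes>\<^bsub>P\<^esub> inv\<^bsub>P\<^esub> g)))"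
      using closed by (simp only: P.m_assoc P.m_closed P.inv_closed P.int_pow_closed)
    finally show ?thesis
      using closed by (simp add: P.m_assoc)
  qed
  then have rel: "\<tau> [^]\<^bsub>P\<^esub> i \<otimes>\<^bsub>P\<^esub> w [^]\<^bsub>P\<^esub> j = \<one>\<^bsub>P\<^esub>"
    using ij(2) conj_eq_one[of g] closed by simp
  obtain \<Phi> where \<Phi>: "\<Phi> \<in> hom P bijections" "\<And>v z. v \<in> V \<Longrightarrow> \<Phi> (vertex_elt v z) = (\<lambda>u. cplx z + u)"
    "\<And>u. \<Phi> (stable e) (cplx y + u) = \<Phi> (stable e) u - cplx x"
    using plane_representation_at_edge[OF e cross(1)[unfolded c_def] cross(2)] by blast
  interpret \<Phi>: group_hom P bijections \<Phi>
    using \<Phi>(1) group_bijections by (simp add: group_hom_def group_hom_axioms_def)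
  have "\<Phi> (stable e \<otimes>\<^bsub>P\<^esub> vertex_elt (tgt e) y) = \<Phi> (vertex_elt (src e) (- x) \<otimes>\<^bsub>P\<^esub> stable e)"
    using closed V \<Phi>(3) by (simp add: \<Phi>(2) fun_eq_iff)
  then have "\<Phi> (stable e \<otimes>\<^bsub>P\<^esub> vertex_elt (tgt e) y \<otimes>\<^bsub>P\<^esub> inv\<^bsub>P\<^esub> stable e) = \<Phi> (vertex_elt (src e) (- x) \<otimes>\<^bsub>P\<^esub> stable e \<otimes>\<^bsub>P\<^esub> inv\<^bsub>P\<^esub> stable e)"
    using closed V by (metis \<Phi>.hom_mult P.inv_closed P.m_closed vertex_elt_closed)
  also have "\<dots> = \<Phi> (inv\<^bsub>P\<^esub> vertex_elt (src e) x)"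
    using closed V by (simp add: P.m_assoc vertex_elt_uminus del: \<Phi>.hom_mult)
  finally have "\<Phi> (inv\<^bsub>P\<^esub> (stable e \<otimes>\<^bsub>P\<^esub> vertex_elt (tgt e) y \<otimes>\<^bsub>P\<^esub> inv\<^bsub>P\<^esub> stable e)) = \<Phi> (vertex_elt (src e) x)"
    using closed by (metis \<Phi>.hom_inv P.inv_closed P.inv_inv P.m_closed)
  then have \<Phi>\<tau>: "\<Phi> \<tau> = \<Phi> (vertex_elt (src e) (x + x))"
    unfolding \<tau>_def vertex_elt_add[OF V(1)] using closed by (metis \<Phi>.hom_mult P.inv_closed P.m_closed)
  have "\<Phi> (\<tau> [^]\<^bsub>P\<^esub> i \<otimes>\<^bsub>P\<^esub> w [^]\<^bsub>P\<^esub> j) = \<Phi> (vertex_elt (src e) (x + x) [^]\<^bsub>P\<^esub> i \<otimes>\<^bsub>P\<^esub> w [^]\<^bsub>P\<^esub> j)"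
    using closed V by (metis \<Phi>.hom_int_pow \<Phi>.hom_mult \<Phi>\<tau> P.int_pow_closed vertex_elt_closed)
  also have "vertex_elt (src e) (x + x) [^]\<^bsub>P\<^esub> i \<otimes>\<^bsub>P\<^esub> w [^]\<^bsub>P\<^esub> j
      = vertex_elt (src e) (int_scale i (x + x) + int_scale j (int_scale n c))"
    unfolding w_def by (simp only: vertex_elt_add[OF V(1)] vertex_elt_scale[OF V(1)])
  finally have "\<Phi> (vertex_elt (src e) (int_scale i (x + x) + int_scale j (int_scale n c))) = \<Phi> \<one>\<^bsub>P\<^esub>"
    using rel by metis
  then have "\<Phi> (vertex_elt (src e) (int_scale i (x + x) + int_scale j (int_scale n c))) = id"
    by (simp only: \<Phi>.hom_one bijections_simps(3))
  then have "cplx (int_scale i (x + x) + int_scale j (int_scale n c)) + 0 = id 0"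
    unfolding \<Phi>(2)[OF V(1)] by (rule fun_cong)
  then have zero: "int_scale i (x + x) + int_scale j (int_scale n c) = 0"
    by (simp only: add_0_right id_apply cplx_simps(4))
  have "cross c (int_scale i (x + x) + int_scale j (int_scale n c)) = 2 * i * cross c x"
    by (simp add: cross_def algebra_simps)
  moreover have "cross c 0 = 0"
    by (simp add: cross_def)
  ultimately have "2 * i * cross c x = 0"
    using zero by metis
  then have "i = 0"
    using cross(1) by simp
  then show False
    using zero ij(1) n(1) edge_map_scale(3)[OF e] by (auto simp: c_def prod_eq_iff)
qed

definition K where "K = {h \<in> H. f h = 0}"

lemma subgroup_K: "subgroup K P"
  by (rule P.subgroupI) (auto simp: K_def f_mult f_inv intro!: exI[of _ "\<one>\<^bsub>P\<^esub>"])

section \<open>Finite generation of the kernel\<close>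

text \<open>The edges over \<open>e\<close> of the Bass--Serre tree correspond to the cosets \<open>p C\<close> of the edge group \<open>C\<close> of
  \<open>e\<close>. They fall into finitely many orbits under \<open>H\<close>, one for each \<open>d \<in> D\<close> at most. An orbit under \<open>H\<close>
  decomposes into at most \<open>F d\<close> orbits under the kernel, where \<open>F d > 0\<close> is the absolute value of \<open>f\<close> at
  some element \<open>\<gamma> (N d) d\<close> of the edge stabilizer: multiplying by a power of this element adjusts \<open>f h\<close> within
  its residue class modulo \<open>F d\<close>.\<close>

lemma edge_orbits:
  assumes e: "e \<in> E"
  obtains Q where "finite Q" "Q \<subseteq> paths v\<^sub>0 (src e)"
    and "\<And>p. p \<in> paths v\<^sub>0 (src e) \<Longrightarrow>
      \<exists>k\<in>K. \<exists>q\<in>Q. \<exists>n. p = k \<otimes>\<^bsub>P\<^esub> q \<otimes>\<^bsub>P\<^esub> vertex_elt (src e) (int_scale n (tail_vec e))"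
proof (cases "paths v\<^sub>0 (src e) = {}")
  case True
  then show ?thesis
    using that[of "{}"] by simp
next
  case False
  then obtain q0 where q0: "q0 \<in> paths v\<^sub>0 (src e)"
    by blast
  have dq0: "d \<otimes>\<^bsub>P\<^esub> q0 \<in> paths v\<^sub>0 (src e)" if "d \<in> D" for d
    using that D_paths q0 by blast
  define \<gamma> where "\<gamma> n d = conj_elt (d \<otimes>\<^bsub>P\<^esub> q0) (src e) (int_scale n (tail_vec e))" for n d
  have "\<exists>n. \<gamma> n d \<in> H \<and> f (\<gamma> n d) \<noteq> 0" if "d \<in> D" for d
    unfolding \<gamma>_def using edge_group_not_killed[OF e dq0[OF that]] by blast
  then obtain N where N: "\<And>d. d \<in> D \<Longrightarrow> \<gamma> (N d) d \<in> H" "\<And>d. d \<in> D \<Longrightarrow> f (\<gamma> (N d) d) \<noteq> 0"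
    by metis
  define F where "F d = \<bar>f (\<gamma> (N d) d)\<bar>" for d
  define rep where "rep d r = (SOME h. h \<in> H \<and> f h mod F d = r)" for d r
  have rep: "rep d (f h mod F d) \<in> H \<and> f (rep d (f h mod F d)) mod F d = f h mod F d" if "h \<in> H" for h d
    unfolding rep_def by (rule someI[of _ h]) (use that in simp)
  define Q where "Q = (\<lambda>(d, r). rep d r \<otimes>\<^bsub>P\<^esub> (d \<otimes>\<^bsub>P\<^esub> q0)) `
    {(d, r) \<in> (SIGMA d:D. {0..<F d}). \<exists>h\<in>H. f h mod F d = r}"
  have "finite Q"
    unfolding Q_def using finite_D
    by (intro finite_imageI finite_subset[OF _ finite_SigmaI[of D "\<lambda>d. {0..<F d}"]]) auto
  moreover have "Q \<subseteq> paths v\<^sub>0 (src e)"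
    unfolding Q_def using rep by (auto intro!: paths_mult[OF subsetD[OF H_paths] dq0])
  moreover have "\<exists>k\<in>K. \<exists>q\<in>Q. \<exists>n. p = k \<otimes>\<^bsub>P\<^esub> q \<otimes>\<^bsub>P\<^esub> vertex_elt (src e) (int_scale n (tail_vec e))"
    if p: "p \<in> paths v\<^sub>0 (src e)" for p
  proof -
    have "p \<otimes>\<^bsub>P\<^esub> inv\<^bsub>P\<^esub> q0 \<in> paths v\<^sub>0 v\<^sub>0"
      using p q0 by blast
    then obtain h d where hd: "h \<in> H" "d \<in> D" "p \<otimes>\<^bsub>P\<^esub> inv\<^bsub>P\<^esub> q0 = h \<otimes>\<^bsub>P\<^esub> d"
      using cover by blast
    define g where "g = d \<otimes>\<^bsub>P\<^esub> q0"
    have g: "g \<in> paths v\<^sub>0 (src e)"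
      unfolding g_def by (rule dq0[OF hd(2)])
    have dP: "d \<in> carrier P" "q0 \<in> carrier P" "h \<in> carrier P" "g \<in> carrier P" "p \<in> carrier P"
      using hd D_paths q0 g p by auto
    have "p = (p \<otimes>\<^bsub>P\<^esub> inv\<^bsub>P\<^esub> q0) \<otimes>\<^bsub>P\<^esub> q0"
      using dP by (simp add: P.m_assoc)
    then have p_eq: "p = h \<otimes>\<^bsub>P\<^esub> g"
      using hd(3) dP by (simp add: g_def P.m_assoc)
    \<comment> \<open>Modulo the kernel, \<open>h\<close> differs from the representative \<open>h'\<close> of its residue class by a power of \<open>\<gamma> (N d) d\<close>.\<close>
  define h' where "h' = rep d (f h mod F d)"
    have h': "h' \<in> H" "f h' mod F d = f h mod F d"
      using rep[OF hd(1)] by (auto simp: h'_def)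
    have h'P: "h' \<in> carrier P"
      using h' by simp
    have Q_mem: "h' \<otimes>\<^bsub>P\<^esub> g \<in> Q"
    proof -
      have "F d > 0"
        using N(2)[OF hd(2)] by (simp add: F_def)
      then show ?thesis
        unfolding Q_def h'_def g_def using hd(1,2)
        by (intro image_eqI[of _ _ "(d, f h mod F d)"]) auto
    qed
    have "F d dvd f h - f h'"
      using h'(2) by (metis mod_eq_dvd_iff)
    then have "f (\<gamma> (N d) d) dvd f h - f h'"
      by (simp add: F_def)
    then obtain m where m: "f h - f h' = f (\<gamma> (N d) d) * m"
      by blast
    define a where "a = vertex_elt (src e) (int_scale (m * N d) (tail_vec e))"
    have aP: "a \<in> carrier P"
      using ends_in_V[OF e] by (simp add: a_def)
    have \<gamma>m: "\<gamma> (N d) d [^]\<^bsub>P\<^esub> m = g \<otimes>\<^bsub>P\<^esub> a \<otimes>\<^bsub>P\<^esub> inv\<^bsub>P\<^esub> g"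
      using conj_elt_scale[OF g, of m "int_scale (N d) (tail_vec e)"]
      unfolding \<gamma>_def g_def[symmetric] a_def by (simp add: conj_elt_def mult.assoc)
    define k where "k = h \<otimes>\<^bsub>P\<^esub> inv\<^bsub>P\<^esub> (\<gamma> (N d) d [^]\<^bsub>P\<^esub> m) \<otimes>\<^bsub>P\<^esub> inv\<^bsub>P\<^esub> h'"
    have "k \<in> K"
      using hd(1) h'(1) N(1)[OF hd(2)] m
      by (simp add: K_def k_def f_mult f_inv f_pow H_pow mult.commute)
    moreover have "k \<otimes>\<^bsub>P\<^esub> (h' \<otimes>\<^bsub>P\<^esub> g) \<otimes>\<^bsub>P\<^esub> a = p"
    proof -
      have "k \<otimes>\<^bsub>P\<^esub> (h' \<otimes>\<^bsub>P\<^esub> g) \<otimes>\<^bsub>P\<^esub> a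
          = h \<otimes>\<^bsub>P\<^esub> (g \<otimes>\<^bsub>P\<^esub> (inv\<^bsub>P\<^esub> a \<otimes>\<^bsub>P\<^esub> (inv\<^bsub>P\<^esub> g \<otimes>\<^bsub>P\<^esub> ((inv\<^bsub>P\<^esub> h' \<otimes>\<^bsub>P\<^esub> h') \<otimes>\<^bsub>P\<^esub> (g \<otimes>\<^bsub>P\<^esub> a)))))"
        unfolding k_def \<gamma>m using dP h'P aP
        by (simp only: P.m_assoc P.m_closed P.inv_closed P.inv_mult_group P.inv_inv)
      also have "\<dots> = p"
      proof -
        have "inv\<^bsub>P\<^esub> g \<otimes>\<^bsub>P\<^esub> (g \<otimes>\<^bsub>P\<^esub> a) = a"
          using dP aP by (simp flip: P.m_assoc)
        then show ?thesis
          using dP h'P aP by (simp add: p_eq)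
      qed
      finally show ?thesis .
    qed
    ultimately show ?thesis
      using Q_mem unfolding a_def by metis
  qed
  ultimately show ?thesis
    using that by blast
qed

text \<open>Vertices of the Bass--Serre tree and the action of \<open>P\<close> on them. A vertex over \<open>v\<close> is a coset of the
  vertex group at \<open>v\<close>; the first component keeps cosets of different vertex groups apart.\<close>

definition vert where "vert v g = (v, g <#\<^bsub>P\<^esub> range (vertex_elt v))"

definition act :: "_ \<Rightarrow> 'v \<times> ('v, 'e, 'a) gog_generator word set set \<Rightarrow> 'v \<times> ('v, 'e, 'a) gog_generator word set set"
  where "act k y = (fst y, k <#\<^bsub>P\<^esub> snd y)"

lemma range_vertex_elt: "v \<in> V \<Longrightarrow> range (vertex_elt v) \<subseteq> carrier P"
  by auto

lemma act_vert:
  assumes "v \<in> V" "k \<in> carrier P" "g \<in> carrier P"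
  shows "act k (vert v g) = vert v (k \<otimes>\<^bsub>P\<^esub> g)"
  using assms by (simp add: act_def vert_def P.lcos_m_assoc[OF range_vertex_elt])

lemma vert_eq_iff:
  assumes "v \<in> V" "h \<in> carrier P" "g \<in> carrier P"
  shows "vert v h = vert v g \<longleftrightarrow> (\<exists>z. h = g \<otimes>\<^bsub>P\<^esub> vertex_elt v z)"
proof
  assume "vert v h = vert v g"
  then have "h <#\<^bsub>P\<^esub> range (vertex_elt v) = g <#\<^bsub>P\<^esub> range (vertex_elt v)"
    by (simp add: vert_def)
  moreover have "h \<otimes>\<^bsub>P\<^esub> vertex_elt v 0 \<in> h <#\<^bsub>P\<^esub> range (vertex_elt v)"
    unfolding l_coset_def by blast
  ultimately have "h \<in> g <#\<^bsub>P\<^esub> range (vertex_elt v)"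
    using assms by simp
  then show "\<exists>z. h = g \<otimes>\<^bsub>P\<^esub> vertex_elt v z"
    by (auto simp: l_coset_def)
next
  assume "\<exists>z. h = g \<otimes>\<^bsub>P\<^esub> vertex_elt v z"
  then obtain z where h: "h = g \<otimes>\<^bsub>P\<^esub> vertex_elt v z"
    by blast
  have shift: "h \<otimes>\<^bsub>P\<^esub> vertex_elt v y = g \<otimes>\<^bsub>P\<^esub> vertex_elt v (z + y)" for y
    using assms by (simp add: h vertex_elt_add P.m_assoc)
  have "g \<otimes>\<^bsub>P\<^esub> vertex_elt v y = h \<otimes>\<^bsub>P\<^esub> vertex_elt v (y - z)" for y
    using shift[of "y - z"] by simp
  with shift have "h <#\<^bsub>P\<^esub> range (vertex_elt v) = g <#\<^bsub>P\<^esub> range (vertex_elt v)"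
    unfolding l_coset_def by fastforce
  then show "vert v h = vert v g"
    by (simp add: vert_def)
qed

text \<open>Stabilizers in the kernel are images of subgroups of \<open>\<int>\<^sup>2\<close>.\<close>

lemma stabilizer_finitely_generated:
  assumes g: "g \<in> paths v\<^sub>0 v"
  shows "\<exists>S. finite S \<and> S \<subseteq> K \<and> generate P S = {k \<in> K. act k (vert v g) = vert v g}"
proof -
  interpret K: subgroup K P
    by (rule subgroup_K)
  have v: "v \<in> V" and gP: "g \<in> carrier P"
    using g paths_verts by auto
  have stab_iff: "act k (vert v g) = vert v g \<longleftrightarrow> (\<exists>z. k = conj_elt g v z)" if "k \<in> K" for k
  proof -
    have kP: "k \<in> carrier P"
      using that by simp
    have "k \<otimes>\<^bsub>P\<^esub> g = g \<otimes>\<^bsub>P\<^esub> vertex_elt v z \<longleftrightarrow> k = conj_elt g v z" for z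
      unfolding conj_elt_def using kP gP v P.inv_solve_right[of k "g \<otimes>\<^bsub>P\<^esub> vertex_elt v z" g] by auto
    then show ?thesis
      using v kP gP by (simp add: act_vert vert_eq_iff)
  qed
  have "\<exists>b c. b \<in> {z. conj_elt g v z \<in> K} \<and> c \<in> {z. conj_elt g v z \<in> K}
      \<and> (\<forall>z\<in>{z. conj_elt g v z \<in> K}. \<exists>m n. z = int_scale m b + int_scale n c)"
  proof (rule int_pair_subgroup_two_generated[of "{z. conj_elt g v z \<in> K}"])
    show "0 \<in> {z. conj_elt g v z \<in> K}"
      using v gP by (simp add: conj_elt_def)
    show "x - y \<in> {z. conj_elt g v z \<in> K}" if "x \<in> {z. conj_elt g v z \<in> K}" "y \<in> {z. conj_elt g v z \<in> K}" for x y
    proof -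
      have "conj_elt g v (x - y) = conj_elt g v x \<otimes>\<^bsub>P\<^esub> inv\<^bsub>P\<^esub> conj_elt g v y"
        using conj_elt_add[OF g, of x "- y"] conj_elt_uminus[OF g, of y] by simp
      then show ?thesis
        using that by simp
    qed
  qed blast
  then obtain b c where bc: "conj_elt g v b \<in> K" "conj_elt g v c \<in> K"
    "\<And>z. conj_elt g v z \<in> K \<Longrightarrow> \<exists>m n. z = int_scale m b + int_scale n c"
    by blast
  let ?S = "{conj_elt g v b, conj_elt g v c}"
  have SP: "?S \<subseteq> carrier P"
    using g by simp
  interpret S: subgroup "generate P ?S" P
    using P.generate_is_subgroup[OF SP] .
  have "subgroup (range (conj_elt g v)) P"
  proof (rule P.subgroupI)
    fix a b assume "a \<in> range (conj_elt g v)" "b \<in> range (conj_elt g v)"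
    then obtain y z where "a = conj_elt g v y" "b = conj_elt g v z"
      by blast
    then show "a \<otimes>\<^bsub>P\<^esub> b \<in> range (conj_elt g v)"
      using conj_elt_add[OF g, of y z] by (metis rangeI)
  next
    fix a assume "a \<in> range (conj_elt g v)"
    then obtain z where "a = conj_elt g v z"
      by blast
    then show "inv\<^bsub>P\<^esub> a \<in> range (conj_elt g v)"
      using conj_elt_uminus[OF g, of z] by (metis rangeI)
  qed (use g in auto)
  then have "subgroup (K \<inter> range (conj_elt g v)) P"
    by (rule P.subgroups_Inter_pair[OF subgroup_K])
  then have gen_le: "generate P ?S \<subseteq> K \<inter> range (conj_elt g v)"
    using bc(1,2) by (intro P.generate_subgroup_incl) auto
  have le_gen: "K \<inter> range (conj_elt g v) \<subseteq> generate P ?S"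
  proof
    fix k assume k: "k \<in> K \<inter> range (conj_elt g v)"
    then obtain z where z: "k = conj_elt g v z"
      by blast
    then obtain m n where "z = int_scale m b + int_scale n c"
      using k bc(3) by blast
    then have "k = conj_elt g v b [^]\<^bsub>P\<^esub> m \<otimes>\<^bsub>P\<^esub> conj_elt g v c [^]\<^bsub>P\<^esub> n"
      using z by (simp only: conj_elt_add[OF g] conj_elt_scale[OF g])
    moreover have "conj_elt g v b \<in> generate P ?S" "conj_elt g v c \<in> generate P ?S"
      by (auto intro: generate.incl)
    ultimately show "k \<in> generate P ?S"
      using P.subgroup_int_pow_closed[OF S.subgroup_axioms] by simp
  qed
  have stab_eq: "{k \<in> K. act k (vert v g) = vert v g} = K \<inter> range (conj_elt g v)"
    using stab_iff by blast
  have "generate P ?S = {k \<in> K. act k (vert v g) = vert v g}"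
    unfolding stab_eq using gen_le le_gen by (rule equalityI)
  moreover have "finite ?S" "?S \<subseteq> K"
    using bc(1,2) by blast+
  ultimately show ?thesis
    by metis
qed

text \<open>The kernel acts cocompactly on the component of the base vertex in the Bass--Serre tree:
  a path of the graph of groups that spells an element of the kernel lifts to an edge path from the
  base vertex to its translate.\<close>

theorem kernel_finitely_generated: "\<exists>S. finite S \<and> S \<subseteq> K \<and> generate P S = K"
proof -
  interpret K: subgroup K P
    by (rule subgroup_K)
  have one_paths: "\<one>\<^bsub>P\<^esub> \<in> paths v\<^sub>0 v\<^sub>0"
    using H_paths H.one_closed by blast
  then have v\<^sub>0: "v\<^sub>0 \<in> V"
    using paths_verts by blast
  have K_paths: "K \<subseteq> paths v\<^sub>0 v\<^sub>0"
    using H_paths by (auto simp: K_def)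
  obtain Q where Q: "\<And>e. e \<in> E \<Longrightarrow> finite (Q e)" "\<And>e. e \<in> E \<Longrightarrow> Q e \<subseteq> paths v\<^sub>0 (src e)"
    "\<And>e p. e \<in> E \<Longrightarrow> p \<in> paths v\<^sub>0 (src e) \<Longrightarrow>
      \<exists>k\<in>K. \<exists>q\<in>Q e. \<exists>n. p = k \<otimes>\<^bsub>P\<^esub> q \<otimes>\<^bsub>P\<^esub> vertex_elt (src e) (int_scale n (tail_vec e))"
  proof -
    define good where "good e Q \<longleftrightarrow> finite Q \<and> Q \<subseteq> paths v\<^sub>0 (src e) \<and> (\<forall>p\<in>paths v\<^sub>0 (src e).
      \<exists>k\<in>K. \<exists>q\<in>Q. \<exists>n. p = k \<otimes>\<^bsub>P\<^esub> q \<otimes>\<^bsub>P\<^esub> vertex_elt (src e) (int_scale n (tail_vec e)))" for e Q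
    have "\<exists>Q. good e Q" if "e \<in> E" for e
    proof (rule edge_orbits[OF that])
      fix Q
      assume "finite Q" "Q \<subseteq> paths v\<^sub>0 (src e)" "\<And>p. p \<in> paths v\<^sub>0 (src e) \<Longrightarrow>
        \<exists>k\<in>K. \<exists>q\<in>Q. \<exists>n. p = k \<otimes>\<^bsub>P\<^esub> q \<otimes>\<^bsub>P\<^esub> vertex_elt (src e) (int_scale n (tail_vec e))"
      then have "good e Q"
        unfolding good_def by (intro conjI ballI)
      then show ?thesis ..
    qed
    then obtain Q where "\<And>e. e \<in> E \<Longrightarrow> good e (Q e)"
      by metis
    then show ?thesis
      unfolding good_def by (intro that[of Q]) simp_all
  qed
  define R where "R = insert (vert v\<^sub>0 \<one>\<^bsub>P\<^esub>)
    (\<Union>e\<in>E. vert (src e) ` Q e \<union> (\<lambda>q. vert (tgt e) (q \<otimes>\<^bsub>P\<^esub> stable e)) ` Q e)"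
  have R: "\<exists>v g. g \<in> paths v\<^sub>0 v \<and> v \<in> V \<and> g \<in> carrier P \<and> r = vert v g" if "r \<in> R" for r
  proof -
    have "\<exists>v g. g \<in> paths v\<^sub>0 v \<and> r = vert v g"
      using that Q(2) one_paths unfolding R_def by blast
    then show ?thesis
      using paths_verts by fastforce
  qed
  define adj where "adj = {(vert (src e) g, vert (tgt e) (g \<otimes>\<^bsub>P\<^esub> stable e)) | e g. e \<in> E \<and> g \<in> paths v\<^sub>0 (src e)}"
  have adj: "\<exists>k\<in>K. \<exists>r\<in>R. \<exists>r'\<in>R. y = act k r \<and> y' = act k r'" if yy: "(y, y') \<in> adj" for y y'
  proof -
    obtain e g where eg: "e \<in> E" "g \<in> paths v\<^sub>0 (src e)" "y = vert (src e) g" "y' = vert (tgt e) (g \<otimes>\<^bsub>P\<^esub> stable e)"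
      using yy unfolding adj_def by blast
    obtain k q n where k: "k \<in> K" "q \<in> Q e" "g = k \<otimes>\<^bsub>P\<^esub> q \<otimes>\<^bsub>P\<^esub> vertex_elt (src e) (int_scale n (tail_vec e))"
      using Q(3)[OF eg(1,2)] by blast
    have "q \<in> paths v\<^sub>0 (src e)"
      using k(2) Q(2)[OF eg(1)] by blast
    then have c: "k \<in> carrier P" "q \<in> carrier P" "src e \<in> V" "tgt e \<in> V" "stable e \<in> carrier P" "g \<in> carrier P"
      using k(1) eg(1,2) ends_in_V by auto
    have "vert (src e) g = vert (src e) (k \<otimes>\<^bsub>P\<^esub> q)"
      using c k(3) vert_eq_iff[of "src e" g "k \<otimes>\<^bsub>P\<^esub> q"] by blast
    then have "y = act k (vert (src e) q)"
      using c eg(3) by (simp add: act_vert)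
    moreover have "g \<otimes>\<^bsub>P\<^esub> stable e = k \<otimes>\<^bsub>P\<^esub> (q \<otimes>\<^bsub>P\<^esub> stable e) \<otimes>\<^bsub>P\<^esub> vertex_elt (tgt e) (int_scale n (head_vec e))"
      using c stable_conj[OF eg(1), of n] by (simp add: k(3) P.m_assoc)
    then have "vert (tgt e) (g \<otimes>\<^bsub>P\<^esub> stable e) = vert (tgt e) (k \<otimes>\<^bsub>P\<^esub> (q \<otimes>\<^bsub>P\<^esub> stable e))"
      using c vert_eq_iff[of "tgt e" "g \<otimes>\<^bsub>P\<^esub> stable e" "k \<otimes>\<^bsub>P\<^esub> (q \<otimes>\<^bsub>P\<^esub> stable e)"] by blast
    then have "y' = act k (vert (tgt e) (q \<otimes>\<^bsub>P\<^esub> stable e))"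
      using c eg(4) by (simp add: act_vert)
    moreover have "vert (src e) q \<in> R" "vert (tgt e) (q \<otimes>\<^bsub>P\<^esub> stable e) \<in> R"
      using k(2) eg(1) unfolding R_def by blast+
    ultimately show ?thesis
      using k(1) by blast
  qed
  have connected: "g \<in> paths v\<^sub>0 v \<Longrightarrow> (vert v g, vert w (g \<otimes>\<^bsub>P\<^esub> h)) \<in> (adj \<union> adj\<inverse>)\<^sup>*"
    if "h \<in> paths v w" for g h v w
    using that
  proof (induction arbitrary: g rule: paths_induct)
    case (one v)
    then show ?case by simp
  next
    case (vertex_elt v z h w)
    have "g \<otimes>\<^bsub>P\<^esub> vertex_elt v z \<in> paths v\<^sub>0 v"
      using vertex_elt by blast
    moreover have "vert v (g \<otimes>\<^bsub>P\<^esub> vertex_elt v z) = vert v g"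
      using vertex_elt vert_eq_iff[of v "g \<otimes>\<^bsub>P\<^esub> vertex_elt v z" g] by (metis P.m_closed paths_closed vertex_elt_closed)
    ultimately show ?case
      using vertex_elt.IH[of "g \<otimes>\<^bsub>P\<^esub> vertex_elt v z"] vertex_elt by (simp add: P.m_assoc)
  next
    case (stable e h w)
    have "g \<otimes>\<^bsub>P\<^esub> stable e \<in> paths v\<^sub>0 (tgt e)"
      using stable by blast
    moreover have "(vert (src e) g, vert (tgt e) (g \<otimes>\<^bsub>P\<^esub> stable e)) \<in> adj \<union> adj\<inverse>"
      using stable unfolding adj_def by blast
    ultimately show ?case
      using stable.IH[of "g \<otimes>\<^bsub>P\<^esub> stable e"] stable by (simp add: P.m_assoc converse_rtrancl_into_rtrancl)
  next
    case (stable_inv e h w)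
    have *: "g \<otimes>\<^bsub>P\<^esub> inv\<^bsub>P\<^esub> stable e \<in> paths v\<^sub>0 (src e)"
      using stable_inv by blast
    have "g \<otimes>\<^bsub>P\<^esub> inv\<^bsub>P\<^esub> stable e \<otimes>\<^bsub>P\<^esub> stable e = g"
      using stable_inv by (simp add: P.m_assoc)
    then have "(vert (src e) (g \<otimes>\<^bsub>P\<^esub> inv\<^bsub>P\<^esub> stable e), vert (tgt e) g) \<in> adj"
      using stable_inv(1) * unfolding adj_def by force
    then have "(vert (tgt e) g, vert (src e) (g \<otimes>\<^bsub>P\<^esub> inv\<^bsub>P\<^esub> stable e)) \<in> adj \<union> adj\<inverse>"
      by blast
    then show ?case
      using stable_inv.IH[OF *] stable_inv by (simp add: P.m_assoc converse_rtrancl_into_rtrancl)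
  qed
  show ?thesis
  proof (rule P.finitely_generated_of_cocompact_action[OF subgroup_K,
        where act = act and R = R and E = "adj \<union> adj\<inverse>" and y\<^sub>0 = "vert v\<^sub>0 \<one>\<^bsub>P\<^esub>"])
    show "finite R"
      unfolding R_def using finite_arcs Q(1) by auto
    show "vert v\<^sub>0 \<one>\<^bsub>P\<^esub> \<in> R"
      by (simp add: R_def)
    show "act (g \<otimes>\<^bsub>P\<^esub> h) r = act g (act h r)" if "g \<in> K" "h \<in> K" "r \<in> R" for g h r
      using R[OF that(3)] that(1,2) by (auto simp: act_vert P.m_assoc)
    show "act \<one>\<^bsub>P\<^esub> r = r" if "r \<in> R" for r
      using R[OF that] by (auto simp: act_vert)
    show "\<exists>k\<in>K. \<exists>r\<in>R. \<exists>r'\<in>R. y = act k r \<and> y' = act k r'" if "(y, y') \<in> adj \<union> adj\<inverse>" for y y'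
      using that adj by blast
    show "(vert v\<^sub>0 \<one>\<^bsub>P\<^esub>, act k (vert v\<^sub>0 \<one>\<^bsub>P\<^esub>)) \<in> (adj \<union> adj\<inverse>)\<^sup>*" if "k \<in> K" for k
      using connected[of k v\<^sub>0 v\<^sub>0 "\<one>\<^bsub>P\<^esub>"] that K_paths one_paths v\<^sub>0 by (auto simp: act_vert)
    show "\<exists>S. finite S \<and> S \<subseteq> K \<and> generate P S = {k \<in> K. act k r = r}" if "r \<in> R" for r
      using R[OF that] stabilizer_finitely_generated by blast
  qed
qed

end

section \<open>Free-by-cyclic tubular groups\<close>

lemma (in group) finite_coset_representatives:
  assumes H: "subgroup H G" and fin: "finite (rcosets H)"
  obtains D where "finite D" "D \<subseteq> carrier G" "\<And>g. g \<in> carrier G \<Longrightarrow> \<exists>h\<in>H. \<exists>d\<in>D. g = h \<otimes> d"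
proof
  interpret H: subgroup H G by fact
  define rep where "rep C = (SOME d. d \<in> C)" for C :: "'a set"
  have rep: "rep (H #> g) \<in> H #> g" if "g \<in> carrier G" for g
    unfolding rep_def using rcos_self[OF that H] by (rule someI)
  show "finite (rep ` (rcosets H))"
    using fin by simp
  show "rep ` (rcosets H) \<subseteq> carrier G"
    using rep r_coset_subset_G[OF H.subset] by (force simp: RCOSETS_def)
  show "\<exists>h\<in>H. \<exists>d\<in>rep ` (rcosets H). g = h \<otimes> d" if g: "g \<in> carrier G" for g
  proof -
    obtain h where h: "h \<in> H" "rep (H #> g) = h \<otimes> g"
      using rep[OF g] by (auto simp: r_coset_def)
    then have "g = inv h \<otimes> rep (H #> g)"
      using g by (simp add: m_assoc[symmetric])
    moreover have "rep (H #> g) \<in> rep ` (rcosets H)"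
      using g by (auto simp: RCOSETS_def)
    ultimately show ?thesis
      using h(1) by blast
  qed
qed

lemma tubular_splitting_coordinates:
  assumes "tubular_splitting G \<G>"
  obtains basis edge_iso v\<^sub>0 where "tubular_graph_of_groups \<G> basis edge_iso"
    and "G \<cong> gog_fundamental_group \<G> v\<^sub>0"
proof -
  interpret gog: graph_of_groups \<G>
    using assms by (simp add: tubular_splitting_def)
  have fin: "finite (arcs (graph \<G>))"
    using assms fin_digraph.finite_arcs by (auto simp: tubular_splitting_def)
  have "\<exists>b. b \<in> iso (integer_group \<times>\<times> integer_group) (vertex_group \<G> v)" if "v \<in> verts (graph \<G>)" for v
  proof -
    have "vertex_group \<G> v \<cong> integer_group \<times>\<times> integer_group"
      using assms that by (simp add: tubular_splitting_def)
    from group.iso_sym[OF gog.vertex_group_is_group[OF that] this] show ?thesis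
      by (auto simp: is_iso_def)
  qed
  then obtain basis where basis: "\<And>v. v \<in> verts (graph \<G>) \<Longrightarrow>
      basis v \<in> iso (integer_group \<times>\<times> integer_group) (vertex_group \<G> v)"
    by metis
  have "\<exists>b. b \<in> iso integer_group (edge_group \<G> e)" if "e \<in> arcs (graph \<G>)" for e
  proof -
    have "edge_group \<G> e \<cong> integer_group"
      using assms that by (simp add: tubular_splitting_def)
    from group.iso_sym[OF gog.edge_group_is_group[OF that] this] show ?thesis
      by (auto simp: is_iso_def)
  qed
  then obtain edge_iso where "\<And>e. e \<in> arcs (graph \<G>) \<Longrightarrow> edge_iso e \<in> iso integer_group (edge_group \<G> e)"
    by metis
  with fin basis have "tubular_graph_of_groups \<G> basis edge_iso"
    by unfold_locales
  then show ?thesis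
    using assms that by (auto simp: tubular_splitting_def)
qed

text \<open>The epimorphism to \<open>\<int>\<close> stays the same: its kernel is free by assumption, and finitely generated by
  \<open>kernel_finitely_generated\<close>.\<close>

theorem tubular_free_by_cyclic_subgroup_imp_Fn_by_Z:
  fixes G :: "'g monoid" and \<G> :: "('v, 'e, 'a, 'b) graph_of_groups"
  assumes "group G" and "tubular_splitting G \<G>"
    and H\<^sub>0: "subgroup H\<^sub>0 G" and index: "finite (rcosets\<^bsub>G\<^esub> H\<^sub>0)"
    and fbc: "free_by_cyclic (G\<lparr>carrier := H\<^sub>0\<rparr>)"
  shows "\<exists>n. Fn_by_Z n (G\<lparr>carrier := H\<^sub>0\<rparr>)"
proof -
  interpret G: group G by fact
  interpret H0: subgroup H\<^sub>0 G by fact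
  obtain basis edge_iso v\<^sub>0 where tub: "tubular_graph_of_groups \<G> basis edge_iso" and "G \<cong> gog_fundamental_group \<G> v\<^sub>0"
    using tubular_splitting_coordinates[OF assms(2)] by metis
  interpret T: tubular_graph_of_groups \<G> basis edge_iso by (rule tub)
  have "gog_fundamental_group \<G> v\<^sub>0 = T.P\<lparr>carrier := T.paths v\<^sub>0 v\<^sub>0\<rparr>"
    by (simp add: gog_fundamental_group_def T.P_def T.paths_def)
  then obtain \<psi> where \<psi>: "\<psi> \<in> iso G (T.P\<lparr>carrier := T.paths v\<^sub>0 v\<^sub>0\<rparr>)"
    using \<open>G \<cong> _\<close> by (auto simp: is_iso_def)
  have \<psi>_inj: "inj_on \<psi> (carrier G)" and \<psi>_range: "\<psi> ` carrier G = T.paths v\<^sub>0 v\<^sub>0"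
    using \<psi> by (auto simp: iso_def bij_betw_def)
  have "\<psi> \<in> hom G T.P"
  proof (rule homI)
    have hom: "\<psi> \<in> hom G (T.P\<lparr>carrier := T.paths v\<^sub>0 v\<^sub>0\<rparr>)"
      using \<psi> by (simp add: iso_def)
    show "\<psi> x \<in> carrier T.P" if "x \<in> carrier G" for x
      using hom_in_carrier[OF hom that] by (simp add: T.paths_closed[of _ v\<^sub>0 v\<^sub>0])
    show "\<psi> (x \<otimes>\<^bsub>G\<^esub> y) = \<psi> x \<otimes>\<^bsub>T.P\<^esub> \<psi> y" if "x \<in> carrier G" "y \<in> carrier G" for x y
      using hom_mult[OF hom that] by simp
  qed
  then interpret \<psi>: group_hom G T.P \<psi>
    using T.P.is_group by (simp add: group_hom_def group_hom_axioms_def \<open>group G\<close>)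
  obtain f\<^sub>0 where f\<^sub>0: "f\<^sub>0 \<in> epi (G\<lparr>carrier := H\<^sub>0\<rparr>) integer_group"
    and free: "is_free (G\<lparr>carrier := kernel (G\<lparr>carrier := H\<^sub>0\<rparr>) integer_group f\<^sub>0\<rparr>)"
    using fbc by (auto simp: free_by_cyclic_def)
  define K\<^sub>0 where "K\<^sub>0 = kernel (G\<lparr>carrier := H\<^sub>0\<rparr>) integer_group f\<^sub>0"
  have K\<^sub>0_def': "K\<^sub>0 = {x \<in> H\<^sub>0. f\<^sub>0 x = 0}"
    by (simp add: K\<^sub>0_def kernel_def)
  have f\<^sub>0_hom: "f\<^sub>0 \<in> hom (G\<lparr>carrier := H\<^sub>0\<rparr>) integer_group"
    using f\<^sub>0 by (simp add: epi_def)
  interpret f0: group_hom "G\<lparr>carrier := H\<^sub>0\<rparr>" integer_group f\<^sub>0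
    using f\<^sub>0_hom G.subgroup_imp_group[OF H\<^sub>0] by (simp add: group_hom_def group_hom_axioms_def)
  have K\<^sub>0: "subgroup K\<^sub>0 G"
    unfolding K\<^sub>0_def by (rule G.incl_subgroup[OF H\<^sub>0 f0.subgroup_kernel])
  obtain X :: "'g set" where X: "G\<lparr>carrier := K\<^sub>0\<rparr> \<cong> free_group X"
    using free by (auto simp: is_free_def K\<^sub>0_def)
  have K\<^sub>0_group: "group (G\<lparr>carrier := K\<^sub>0\<rparr>)"
    by (rule G.subgroup_imp_group[OF K\<^sub>0])
  have K\<^sub>0_dependent: "\<exists>(i::int) (j::int). (i, j) \<noteq> (0, 0) \<and> a [^]\<^bsub>G\<^esub> i \<otimes>\<^bsub>G\<^esub> b [^]\<^bsub>G\<^esub> j = \<one>\<^bsub>G\<^esub>"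
    if "a \<in> K\<^sub>0" "b \<in> K\<^sub>0" "a \<otimes>\<^bsub>G\<^esub> b = b \<otimes>\<^bsub>G\<^esub> a" for a b
    using free_commuting_dependent[OF K\<^sub>0_group X, of a b] that
    by (simp add: G.int_pow_consistent[OF K\<^sub>0, symmetric])
  obtain D\<^sub>0 where D\<^sub>0: "finite D\<^sub>0" "D\<^sub>0 \<subseteq> carrier G"
    "\<And>g. g \<in> carrier G \<Longrightarrow> \<exists>h\<in>H\<^sub>0. \<exists>d\<in>D\<^sub>0. g = h \<otimes>\<^bsub>G\<^esub> d"
    using G.finite_coset_representatives[OF H\<^sub>0 index] by metis
  define f where "f x = f\<^sub>0 (inv_into (carrier G) \<psi> x)" for x
  have f_\<psi>: "f (\<psi> h) = f\<^sub>0 h" if "h \<in> H\<^sub>0" for h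
    using that \<psi>_inj by (simp add: f_def)
  interpret S: tubular_finite_index_subgroup \<G> basis edge_iso v\<^sub>0 "\<psi> ` H\<^sub>0" "\<psi> ` D\<^sub>0" f
  proof (rule tubular_finite_index_subgroup.intro[OF tub], rule tubular_finite_index_subgroup_axioms.intro)
    show "subgroup (\<psi> ` H\<^sub>0) T.P"
      by (rule \<psi>.subgroup_img_is_subgroup[OF H\<^sub>0])
    show "\<psi> ` H\<^sub>0 \<subseteq> T.paths v\<^sub>0 v\<^sub>0" "\<psi> ` D\<^sub>0 \<subseteq> T.paths v\<^sub>0 v\<^sub>0"
      using \<psi>_range H0.subset D\<^sub>0(2) by blast+
    show "finite (\<psi> ` D\<^sub>0)"
      using D\<^sub>0(1) by simp
    show "\<exists>h\<in>\<psi> ` H\<^sub>0. \<exists>d\<in>\<psi> ` D\<^sub>0. g = h \<otimes>\<^bsub>T.P\<^esub> d" if "g \<in> T.paths v\<^sub>0 v\<^sub>0" for g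
    proof -
      have "g \<in> \<psi> ` carrier G"
        using that by (simp only: \<psi>_range)
      then obtain g' where g': "g' \<in> carrier G" "g = \<psi> g'"
        by (elim imageE)
      obtain h d where hd: "h \<in> H\<^sub>0" "d \<in> D\<^sub>0" "g' = h \<otimes>\<^bsub>G\<^esub> d"
        using D\<^sub>0(3)[OF g'(1)] by blast
      then have "h \<in> carrier G" "d \<in> carrier G"
        using D\<^sub>0(2) H0.subset by blast+
      then have "g = \<psi> h \<otimes>\<^bsub>T.P\<^esub> \<psi> d"
        unfolding g'(2) hd(3) by (rule \<psi>.hom_mult)
      then show ?thesis
        using imageI[OF hd(1), of \<psi>] imageI[OF hd(2), of \<psi>] by (intro bexI)
    qed
    show "f (x \<otimes>\<^bsub>T.P\<^esub> y) = f x + f y" if xy: "x \<in> \<psi> ` H\<^sub>0" "y \<in> \<psi> ` H\<^sub>0" for x y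
    proof -
      obtain a b where ab: "a \<in> H\<^sub>0" "b \<in> H\<^sub>0" "x = \<psi> a" "y = \<psi> b"
        using xy by blast
      then have "x \<otimes>\<^bsub>T.P\<^esub> y = \<psi> (a \<otimes>\<^bsub>G\<^esub> b)"
        by simp
      then have "f (x \<otimes>\<^bsub>T.P\<^esub> y) = f\<^sub>0 (a \<otimes>\<^bsub>G\<^esub> b)"
        using ab f_\<psi>[of "a \<otimes>\<^bsub>G\<^esub> b"] by (simp del: \<psi>.hom_mult)
      then show ?thesis
        using ab f0.hom_mult[of a b] f_\<psi> by simp
    qed
    show "\<exists>(i::int) (j::int). (i, j) \<noteq> (0, 0) \<and> x [^]\<^bsub>T.P\<^esub> i \<otimes>\<^bsub>T.P\<^esub> y [^]\<^bsub>T.P\<^esub> j = \<one>\<^bsub>T.P\<^esub>"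
      if xy: "x \<in> \<psi> ` H\<^sub>0" "y \<in> \<psi> ` H\<^sub>0" "f x = 0" "f y = 0" "x \<otimes>\<^bsub>T.P\<^esub> y = y \<otimes>\<^bsub>T.P\<^esub> x" for x y
    proof -
      obtain a b where ab: "a \<in> H\<^sub>0" "b \<in> H\<^sub>0" "x = \<psi> a" "y = \<psi> b"
        using xy by blast
      have "\<psi> (a \<otimes>\<^bsub>G\<^esub> b) = \<psi> (b \<otimes>\<^bsub>G\<^esub> a)"
        using ab xy(5) by simp
      then have "a \<otimes>\<^bsub>G\<^esub> b = b \<otimes>\<^bsub>G\<^esub> a"
        using ab \<psi>_inj by (meson G.m_closed H0.mem_carrier inj_onD)
      then obtain i j :: int where ij: "(i, j) \<noteq> (0, 0)" "a [^]\<^bsub>G\<^esub> i \<otimes>\<^bsub>G\<^esub> b [^]\<^bsub>G\<^esub> j = \<one>\<^bsub>G\<^esub>"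
        using K\<^sub>0_dependent[of a b] ab xy(3,4) f_\<psi> by (auto simp: K\<^sub>0_def')
      have "\<psi> (a [^]\<^bsub>G\<^esub> i \<otimes>\<^bsub>G\<^esub> b [^]\<^bsub>G\<^esub> j) = x [^]\<^bsub>T.P\<^esub> i \<otimes>\<^bsub>T.P\<^esub> y [^]\<^bsub>T.P\<^esub> j"
        using ab by (simp add: \<psi>.hom_int_pow)
      then show ?thesis
        using ij by (metis \<psi>.hom_one)
    qed
  qed
  have K_eq: "S.K = \<psi> ` K\<^sub>0"
    using f_\<psi> by (auto simp: S.K_def K\<^sub>0_def')
  obtain S where S: "finite S" "S \<subseteq> \<psi> ` K\<^sub>0" "generate T.P S = \<psi> ` K\<^sub>0"
    using S.kernel_finitely_generated[unfolded K_eq] by (elim exE conjE)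
  obtain S\<^sub>0 where S\<^sub>0: "S\<^sub>0 \<subseteq> K\<^sub>0" "finite S\<^sub>0" "S = \<psi> ` S\<^sub>0"
    using finite_subset_image[OF S(1,2)] by metis
  have K\<^sub>0_carrier: "K\<^sub>0 \<subseteq> carrier G"
    by (rule subgroup.subset[OF K\<^sub>0])
  have "\<psi> ` generate G S\<^sub>0 = \<psi> ` K\<^sub>0"
    using S(3) S\<^sub>0 K\<^sub>0_carrier \<psi>.generate_img[of S\<^sub>0] by auto
  then have "generate G S\<^sub>0 = K\<^sub>0"
    using inj_on_image_eq_iff[OF \<psi>_inj G.generate_incl[OF subset_trans[OF S\<^sub>0(1) K\<^sub>0_carrier]] K\<^sub>0_carrier]
    by simp
  then have "generate (G\<lparr>carrier := K\<^sub>0\<rparr>) S\<^sub>0 = K\<^sub>0"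
    using G.generate_consistent[OF S\<^sub>0(1) K\<^sub>0] by simp
  then obtain n where "is_free_of_rank n (G\<lparr>carrier := K\<^sub>0\<rparr>)"
    using free_finitely_generated_imp_finite_rank[OF K\<^sub>0_group X S\<^sub>0(2)] S\<^sub>0(1) by auto
  then show ?thesis
    using f\<^sub>0 by (auto simp: Fn_by_Z_def K\<^sub>0_def)
qed

theorem theorem3p2:
  fixes G :: "'g monoid"
    and \<G> :: "('v, 'e, 'a, 'b) graph_of_groups"
  assumes "group G"
    and "tubular_splitting G \<G>"
  shows "(free_by_cyclic G \<longrightarrow> (\<exists>n. Fn_by_Z n G)) \<and>
    (virtually free_by_cyclic G \<longrightarrow> (\<exists>n. virtually (Fn_by_Z n) G))"
proof -
  interpret group G by fact
  have "rcosets\<^bsub>G\<^esub> carrier G \<subseteq> {carrier G}"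
    using coset_join2[OF _ subgroup_self] by (auto simp: RCOSETS_def)
  then have "finite (rcosets\<^bsub>G\<^esub> carrier G)"
    by (rule finite_subset) simp
  then have "free_by_cyclic G \<longrightarrow> (\<exists>n. Fn_by_Z n G)"
    using tubular_free_by_cyclic_subgroup_imp_Fn_by_Z[OF assms subgroup_self] by simp
  moreover have "virtually free_by_cyclic G \<longrightarrow> (\<exists>n. virtually (Fn_by_Z n) G)"
    using tubular_free_by_cyclic_subgroup_imp_Fn_by_Z[OF assms] unfolding virtually_def by metis
  ultimately show ?thesis ..
qed

end
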